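(* Let $M\ge 1$ and let $\underline{f}=(f_1,\dots,f_M):[a,b]\to\mathbb{R}^M$ be a continuous and rectifiable curve $C$. Then $$\ell(C)=\int_a^b \|\underline{f}'(x)\|\,dx$$ if and only if all the component functions $f_m$ ($m=1,\dots,M$) are absolutely continuous on $[a,b]$.
   Context: A curve $C$ is a function $\underline{f}:[a,b]\to\mathbb{R}^M$; $\|\cdot\|$ is the Euclidean norm. Its length is $\ell(C)=\sup_P\sum_{i=1}^n\|\underline{f}(x_i)-\underline{f}(x_{i-1})\|$, the supremum over all partitions $P: a=x_0<x_1<\dots<x_n=b$; $C$ is rectifiable if $\ell(C)<+\infty$. If $C$ is rectifiable, each $f_m$ is of bounded variation, so $\underline{f}'=(f_1',\dots,f_M')$ exists almost everywhere and is Lebesgue integrable; the integral is a Lebesgue integral. *)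

theory Defs
  imports "HOL-Analysis.Analysis"
begin

definition is_partition :: "real \<Rightarrow> real \<Rightarrow> nat \<Rightarrow> (nat \<Rightarrow> real) \<Rightarrow> bool" where
  "is_partition a b n x \<longleftrightarrow> x 0 = a \<and> x n = b \<and> (\<forall>i<n. x i < x (Suc i))"

definition polygon_length :: "(real \<Rightarrow> 'a::real_normed_vector) \<Rightarrow> nat \<Rightarrow> (nat \<Rightarrow> real) \<Rightarrow> real" where
  "polygon_length f n x = (\<Sum>i=1..n. norm (f (x i) - f (x (i - 1))))"

definition curve_length :: "real \<Rightarrow> real \<Rightarrow> (real \<Rightarrow> 'a::real_normed_vector) \<Rightarrow> ennreal" where
  "curve_length a b f = (SUP (n, x) \<in> {(n, x). is_partition a b n x}. ennreal (polygon_length f n x))"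

definition rectifiable :: "real \<Rightarrow> real \<Rightarrow> (real \<Rightarrow> 'a::real_normed_vector) \<Rightarrow> bool" where
  "rectifiable a b f \<longleftrightarrow> curve_length a b f < \<infinity>"

definition absolutely_continuous_on :: "real \<Rightarrow> real \<Rightarrow> (real \<Rightarrow> real) \<Rightarrow> bool" where
  "absolutely_continuous_on a b g \<longleftrightarrow>
     (\<forall>\<epsilon>>0. \<exists>\<delta>>0. \<forall>(n::nat) u v.
        (\<forall>i<n. a \<le> u i \<and> u i < v i \<and> v i \<le> b) \<longrightarrow>
        disjoint_family_on (\<lambda>i. {u i<..<v i}) {..<n} \<longrightarrow>
        (\<Sum>i<n. v i - u i) < \<delta> \<longrightarrow>
        (\<Sum>i<n. \<bar>g (v i) - g (u i)\<bar>) < \<epsilon>)"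

(* Derivatives are taken within [a,b], so that values of f outside [a,b] play no role.
   Where some component is not differentiable, the value is arbitrary; for a rectifiable
   curve this happens only on a null set, hence integration against the complete
   measure lebesgue is unaffected. *)
definition curve_deriv :: "real \<Rightarrow> real \<Rightarrow> (real \<Rightarrow> real ^ 'M) \<Rightarrow> real \<Rightarrow> real ^ 'M" where
  "curve_deriv a b f x = (\<chi> m. vector_derivative (\<lambda>t. f t $ m) (at x within {a..b}))"

end

theory Submission
  imports Defs
begin

text \<open>
  The length of every arc is at least the integral of the speed over it: the speeds of inscribed polygons converge to the
  speed of the curve wherever it is differentiable, the integral of a polygon's speed is its length, and Fatou's lemma
  compares the limits (\<open>nn_integral_speed_le_curve_length\<close>). This requires that a rectifiable curve be differentiable
  almost everywhere (\<open>rectifiable_imp_differentiable_ae\<close>), which is Lebesgue's theorem for functions of bounded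
  variation. It is derived here from the Vitali covering theorem: where the difference quotients of a function oscillate,
  any partition misses a definite amount of variation, so the set of such points is as small as the gap between variation
  and polygon length can be made.

  If the components are absolutely continuous, each increment of a component is the integral of its derivative
  (\<open>absolutely_continuous_has_integral\<close>). Hence every chord is at most the integral of the speed over its interval, and so
  is every inscribed polygon over the whole interval; the length cannot exceed the integral of the speed.

  If conversely length and integral agree on \<open>{a..b}\<close>, they agree on every subinterval, because length is superadditive,
  the integral is additive, and the integral never exceeds the length. The increment of a component over an interval is
  at most the length of the arc, which is now an integral of the speed, so absolute continuity of the components is
  inherited from that of the integral (\<open>nn_integral_absolutely_continuous\<close>).
\<close>

section \<open>Partitions and length\<close>

lemma polygon_length_lessThan:
  "polygon_length f n x = (\<Sum>i<n. norm (f (x (Suc i)) - f (x i)))"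
  unfolding polygon_length_def
  by (rule sum.reindex_bij_witness[of _ Suc "\<lambda>i. i - 1"]) auto

lemma polygon_length_nonneg: "0 \<le> polygon_length f n x"
  by (simp add: polygon_length_lessThan sum_nonneg)

lemma polygon_length_le_curve_length:
  assumes "is_partition a b n x"
  shows "ennreal (polygon_length f n x) \<le> curve_length a b f"
  unfolding curve_length_def using assms by (intro SUP_upper2[of "(n, x)"]) auto

lemma is_partition_mono:
  assumes "is_partition a b n x" "i \<le> j" "j \<le> n"
  shows "x i \<le> x j"
  using assms(2,3)
proof (induction j rule: dec_induct)
  case (step m)
  then have "x m < x (Suc m)" using assms(1) by (auto simp: is_partition_def)
  with step show ?case by auto
qed simp

lemma is_partition_bounds:
  assumes "is_partition a b n x" "i \<le> n"
  shows "a \<le> x i" "x i \<le> b"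
  using is_partition_mono[OF assms(1), of 0 i] is_partition_mono[OF assms(1), of i n] assms
  by (auto simp: is_partition_def)

lemma is_partition_cell:
  assumes p: "is_partition a b n x" and t: "a \<le> t" "t < b"
  obtains i where "i < n" "x i \<le> t" "t < x (Suc i)"
    "\<And>j. j < n \<Longrightarrow> j \<noteq> i \<Longrightarrow> t \<notin> {x j..<x (Suc j)}"
proof -
  define i where "i = Max {i. i \<le> n \<and> x i \<le> t}"
  have ends: "x 0 = a" "x n = b" using p by (auto simp: is_partition_def)
  have fin: "finite {i. i \<le> n \<and> x i \<le> t}" by auto
  have "0 \<in> {i. i \<le> n \<and> x i \<le> t}" using t ends by auto
  then have "i \<in> {i. i \<le> n \<and> x i \<le> t}" unfolding i_def by (intro Max_in[OF fin]) auto
  then have i: "i \<le> n" "x i \<le> t" by auto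
  have max: "j \<le> i" if "j \<le> n" "x j \<le> t" for j
    unfolding i_def using that by (intro Max_ge[OF fin]) auto
  have "i \<noteq> n" using i t ends by auto
  then have "i < n" using i by auto
  moreover have "t < x (Suc i)" using max[of "Suc i"] \<open>i < n\<close> by (auto simp: not_le[symmetric])
  moreover have "t \<notin> {x j..<x (Suc j)}" if "j < n" "j \<noteq> i" for j
    using max[of j] is_partition_mono[OF p, of "Suc j" i] i that by (cases "j \<le> i") auto
  ultimately show ?thesis using i(2) that by blast
qed

lemma is_partition_exists:
  assumes "a \<le> b"
  obtains n x where "is_partition a b n x" "polygon_length f n x = norm (f b - f a)"
proof (cases "a = b")
  case True
  then show ?thesis by (intro that[of 0 "\<lambda>_. a"]) (auto simp: is_partition_def polygon_length_lessThan)
next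
  case False
  then show ?thesis using assms
    by (intro that[of 1 "\<lambda>i. if i = 0 then a else b"]) (auto simp: is_partition_def polygon_length_lessThan)
qed

lemma norm_diff_le_curve_length:
  assumes "a \<le> b"
  shows "ennreal (norm (f b - f a)) \<le> curve_length a b f"
  using is_partition_exists[OF assms, of f] polygon_length_le_curve_length by metis

lemma sum_lessThan_add: "(\<Sum>i<n + m. g i) = (\<Sum>i<n. g i) + (\<Sum>i<m. g (n + i :: nat) :: real)"
  by (induction m) (simp_all add: add.assoc)

lemma is_partition_concat:
  assumes x: "is_partition a c n x" and y: "is_partition c b m y"
  defines "z \<equiv> \<lambda>i. if i \<le> n then x i else y (i - n)"
  shows "is_partition a b (n + m) z"
    and "polygon_length f (n + m) z = polygon_length f n x + polygon_length f m y"
proof -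
  have z1: "z i = x i" if "i \<le> n" for i using that by (simp add: z_def)
  have z2: "z (n + i) = y i" for i
    using x y by (cases "i = 0") (auto simp: z_def is_partition_def)
  show "is_partition a b (n + m) z"
    unfolding is_partition_def
  proof (intro conjI allI impI)
    show "z 0 = a" using x z1[of 0] by (simp add: is_partition_def)
    show "z (n + m) = b" using y z2[of m] by (simp add: is_partition_def)
    fix i assume i: "i < n + m"
    show "z i < z (Suc i)"
    proof (cases "i < n")
      case True
      then show ?thesis using x by (simp add: z1 is_partition_def)
    next
      case False
      then obtain j where "i = n + j" using le_Suc_ex[of n i] by auto
      with i y show ?thesis using z2[of j] z2[of "Suc j"] by (simp add: is_partition_def)
    qed
  qed
  have "(\<Sum>i<n. norm (f (z (Suc i)) - f (z i))) = (\<Sum>i<n. norm (f (x (Suc i)) - f (x i)))"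
    by (intro sum.cong) (auto simp: z1)
  moreover have "(\<Sum>i<m. norm (f (z (Suc (n + i))) - f (z (n + i)))) = (\<Sum>i<m. norm (f (y (Suc i)) - f (y i)))"
    using z2 by (metis add_Suc_right)
  ultimately show "polygon_length f (n + m) z = polygon_length f n x + polygon_length f m y"
    unfolding polygon_length_lessThan sum_lessThan_add by simp
qed

text \<open>Concatenated partitions of the two pieces are among the partitions of the whole interval.\<close>
lemma curve_length_superadditive:
  assumes "a \<le> c" "c \<le> b"
  shows "curve_length a c f + curve_length c b f \<le> curve_length a b f"
proof -
  have ne1: "{(n, x). is_partition a c n x} \<noteq> {}" using is_partition_exists[OF assms(1)] by (auto; metis)
  have ne2: "{(n, x). is_partition c b n x} \<noteq> {}" using is_partition_exists[OF assms(2)] by (auto; metis)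
  have *: "ennreal (polygon_length f n x) + ennreal (polygon_length f m y) \<le> curve_length a b f"
    if "is_partition a c n x" "is_partition c b m y" for n x m y
    using polygon_length_le_curve_length[OF is_partition_concat(1)[OF that], of f]
    unfolding is_partition_concat(2)[OF that]
    by (simp add: polygon_length_nonneg)
  have **: "ennreal (polygon_length f n x) + curve_length c b f \<le> curve_length a b f"
    if "is_partition a c n x" for n x
    unfolding curve_length_def[of c b] add.commute[of "ennreal _"]
    by (subst ennreal_SUP_add_left[symmetric, OF ne2])
       (use that * in \<open>auto intro!: SUP_least simp: add.commute\<close>)
  show ?thesis
    unfolding curve_length_def[of a c]
    by (subst ennreal_SUP_add_left[symmetric, OF ne1]) (use ** in \<open>auto intro!: SUP_least\<close>)
qed

lemma curve_length_superadditive3: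
  assumes "a \<le> u" "u \<le> v" "v \<le> b"
  shows "curve_length a u f + curve_length u v f + curve_length v b f \<le> curve_length a b f"
proof -
  have "curve_length a u f + curve_length u v f + curve_length v b f \<le> curve_length a v f + curve_length v b f"
    by (intro add_right_mono curve_length_superadditive assms)
  also have "\<dots> \<le> curve_length a b f"
    using assms by (intro curve_length_superadditive) auto
  finally show ?thesis .
qed

text \<open>A real-valued form of the length of the initial piece, so that it can be used as a monotone function in
  differences; it is meaningful for rectifiable curves only.\<close>
definition arc_length :: "real \<Rightarrow> (real \<Rightarrow> 'a::real_normed_vector) \<Rightarrow> real \<Rightarrow> real" where
  "arc_length a f t = enn2real (curve_length a t f)"

lemma arc_length_nonneg: "0 \<le> arc_length a f t"
  by (simp add: arc_length_def)

lemma ennreal_arc_length: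
  assumes "rectifiable a b f" "a \<le> t" "t \<le> b"
  shows "ennreal (arc_length a f t) = curve_length a t f"
proof -
  have "curve_length a t f \<le> curve_length a t f + curve_length t b f" by simp
  also have "\<dots> \<le> curve_length a b f" by (rule curve_length_superadditive[OF assms(2,3)])
  also have "\<dots> < \<infinity>" using assms(1) by (simp add: rectifiable_def)
  finally show ?thesis by (simp add: arc_length_def)
qed

text \<open>For a real function \<open>g\<close> this says that both \<open>arc_length a g - g\<close> and \<open>arc_length a g + g\<close> are nondecreasing
  (the Jordan decomposition), which is what the differentiability proof exploits.\<close>
lemma norm_diff_le_arc_length_diff:
  assumes "rectifiable a b f" "a \<le> u" "u \<le> v" "v \<le> b"
  shows "norm (f v - f u) \<le> arc_length a f v - arc_length a f u"
proof -
  have "ennreal (arc_length a f u) + ennreal (norm (f v - f u)) \<le> ennreal (arc_length a f v)"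
    using curve_length_superadditive[of a u v f] norm_diff_le_curve_length[of u v f] assms
    by (simp add: ennreal_arc_length[OF assms(1)])
      (metis add_left_mono order_trans)
  then have "arc_length a f u + norm (f v - f u) \<le> arc_length a f v"
    by (simp add: arc_length_nonneg flip: ennreal_plus)
  then show ?thesis by simp
qed

lemma polygon_length_approaches_arc_length:
  assumes "rectifiable a b f" "a \<le> b" "0 < e"
  obtains n x where "is_partition a b n x" "arc_length a f b - e < polygon_length f n x"
proof (cases "arc_length a f b - e < 0")
  case True
  obtain n x where "is_partition a b n x" using is_partition_exists[OF assms(2)] by metis
  then show ?thesis using True polygon_length_nonneg[of f n x] that by fastforce
next
  case False
  have "ennreal (arc_length a f b - e) < ennreal (arc_length a f b)"
    using False assms(3) by (simp add: ennreal_less_iff)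
  also have "\<dots> = curve_length a b f"
    using assms by (intro ennreal_arc_length) auto
  finally obtain n x where "is_partition a b n x" "ennreal (arc_length a f b - e) < ennreal (polygon_length f n x)"
    unfolding curve_length_def less_SUP_iff by auto
  with False show ?thesis by (intro that) (auto simp: ennreal_less_iff)
qed

lemma arc_length_start: "arc_length a f a = 0"
proof -
  have "n = 0" if "is_partition a a n x" for n x
  proof (rule ccontr)
    assume "n \<noteq> 0"
    then have "x 0 < x 1" "x 1 \<le> a" using that is_partition_bounds[OF that, of 1]
      by (auto simp: is_partition_def)
    then show False using that by (simp add: is_partition_def)
  qed
  then have "curve_length a a f \<le> 0"
    unfolding curve_length_def by (intro SUP_least) (force simp: polygon_length_def)
  then show ?thesis by (simp add: arc_length_def)
qed

text \<open>This covers both the components of a curve (\<open>c = 0\<close>) and a function with a linear function subtracted.\<close>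
lemma rectifiable_if_increments_dominated:
  assumes "\<And>u v. a \<le> u \<Longrightarrow> u \<le> v \<Longrightarrow> v \<le> b \<Longrightarrow> norm (h v - h u) \<le> norm (f v - f u) + c * (v - u)" "a \<le> b"
    and "rectifiable a b f"
  shows "rectifiable a b h"
proof -
  have "ennreal (polygon_length h n x) \<le> ennreal (arc_length a f b + c * (b - a))"
    if p: "is_partition a b n x" for n x
  proof -
    have "polygon_length h n x \<le> (\<Sum>i<n. norm (f (x (Suc i)) - f (x i)) + c * (x (Suc i) - x i))"
      unfolding polygon_length_lessThan
    proof (intro sum_mono assms(1))
      fix i assume "i \<in> {..<n}"
      then show "a \<le> x i" "x i \<le> x (Suc i)" "x (Suc i) \<le> b"
        using is_partition_bounds[OF p, of i] is_partition_bounds[OF p, of "Suc i"] is_partition_mono[OF p, of i "Suc i"]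
        by auto
    qed
    also have "\<dots> = polygon_length f n x + c * (b - a)"
      using p sum_lessThan_telescope[of x n]
      by (simp add: polygon_length_lessThan sum.distrib sum_distrib_left[symmetric] is_partition_def)
    also have "polygon_length f n x \<le> arc_length a f b"
    proof -
      have "ennreal (polygon_length f n x) \<le> ennreal (arc_length a f b)"
        using polygon_length_le_curve_length[OF p] ennreal_arc_length[OF assms(3,2)] by simp
      then show ?thesis by (subst (asm) ennreal_le_iff) (auto simp: arc_length_def)
    qed
    finally show ?thesis by (intro ennreal_leI) simp
  qed
  then have "curve_length a b h \<le> ennreal (arc_length a f b + c * (b - a))"
    unfolding curve_length_def by (intro SUP_least) auto
  then show ?thesis unfolding rectifiable_def by (rule le_less_trans) simp
qed

section \<open>Steep intervals of a monotone function\<close>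

lemma sum_increments_le:
  fixes H :: "real \<Rightarrow> real"
  assumes "finite F" and mono: "\<And>x y. c \<le> x \<Longrightarrow> x \<le> y \<Longrightarrow> y \<le> d \<Longrightarrow> H x \<le> H y"
    and "\<And>i. i \<in> F \<Longrightarrow> c \<le> u i \<and> u i < v i \<and> v i \<le> d" "c \<le> d"
    and "\<And>i j. i \<in> F \<Longrightarrow> j \<in> F \<Longrightarrow> i \<noteq> j \<Longrightarrow> disjnt {u i..v i} {u j..v j}"
  shows "(\<Sum>i\<in>F. H (v i) - H (u i)) \<le> H d - H c"
  using assms
proof (induction F arbitrary: d rule: finite_ranking_induct[where f = u])
  case (insert i F)
  show ?case
  proof (cases "i \<in> F")
    case True
    then show ?thesis using insert by (simp add: insert_absorb)
  next
    case False
    have i: "c \<le> u i" "u i < v i" "v i \<le> d" using insert.prems(2)[of i] by auto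
    have "v j \<le> u i" if "j \<in> F" for j
    proof (rule ccontr)
      assume "\<not> v j \<le> u i"
      moreover have "u j \<le> u i" using insert that by auto
      ultimately have "u i \<in> {u i..v i}" "u i \<in> {u j..v j}" using i by auto
      then show False using insert.prems(4)[of i j] that False by (auto simp: disjnt_iff)
    qed
    then have "(\<Sum>j\<in>F. H (v j) - H (u j)) \<le> H (u i) - H c"
    proof (intro insert.IH)
      show "H x \<le> H y" if "c \<le> x" "x \<le> y" "y \<le> u i" for x y
        using that i by (intro insert.prems(1)) auto
    qed (use insert.prems i in auto)
    moreover have "H (v i) \<le> H d" using insert.prems(1) i by auto
    ultimately show ?thesis using insert.hyps False by simp
  qed
qed auto

text \<open>The weak-type estimate behind every exceptional set below. Vitali covering extracts from the steep intervals
  countably many disjoint ones that cover almost all of \<open>S\<close>; each is at most \<open>1 / \<alpha>\<close> times as long as the increase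
  of \<open>H\<close> over it, and the increases over disjoint intervals add up to at most the total increase. The outer measure
  is expressed by a measurable superset because \<open>S\<close> need not be known to be measurable.\<close>
lemma steep_set_outer_measure:
  fixes H :: "real \<Rightarrow> real"
  assumes mono: "\<And>x y. c \<le> x \<Longrightarrow> x \<le> y \<Longrightarrow> y \<le> d \<Longrightarrow> H x \<le> H y" and "0 < \<alpha>" "c \<le> d"
    and S: "\<And>x e. x \<in> S \<Longrightarrow> 0 < e \<Longrightarrow> \<exists>u v. c \<le> u \<and> u \<le> x \<and> x \<le> v \<and> v \<le> d \<and> u < v \<and> v - u < e \<and>
               \<alpha> * (v - u) \<le> H v - H u"
  obtains T where "S \<subseteq> T" "T \<in> lmeasurable" "measure lebesgue T \<le> (H d - H c) / \<alpha>"
proof -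
  define K where "K = {(u, v). c \<le> u \<and> u < v \<and> v \<le> d \<and> \<alpha> * (v - u) \<le> H v - H u}"
  define m :: "real \<times> real \<Rightarrow> real" where "m = (\<lambda>(u, v). (u + v) / 2)"
  define r :: "real \<times> real \<Rightarrow> real" where "r = (\<lambda>(u, v). (v - u) / 2)"
  have ball: "cball (m i) (r i) = {fst i..snd i}" for i
    by (auto simp: m_def r_def cball_eq_atLeastAtMost field_simps split: prod.split)
  obtain C where C: "countable C" "C \<subseteq> K"
     "pairwise (\<lambda>i j. disjnt (cball (m i) (r i)) (cball (m j) (r j))) C"
     "negligible (S - (\<Union>i\<in>C. cball (m i) (r i)))"
  proof (rule Vitali_covering_theorem_cballs[of K r S m])
    show "0 < r i" if "i \<in> K" for i using that by (auto simp: K_def r_def)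
    show "\<exists>i. i \<in> K \<and> x \<in> cball (m i) (r i) \<and> r i < e" if x: "x \<in> S" "0 < e" for x e
    proof -
      from S[OF x] obtain u v where "c \<le> u" "u \<le> x" "x \<le> v" "v \<le> d" "u < v" "v - u < e" "\<alpha> * (v - u) \<le> H v - H u"
        by auto
      then show ?thesis by (intro exI[of _ "(u, v)"]) (unfold ball, auto simp: K_def r_def)
    qed
  qed
  let ?U = "\<Union>i\<in>C. {fst i..snd i}"
  have bound: "measure lebesgue (\<Union>i\<in>F. {fst i..snd i}) \<le> (H d - H c) / \<alpha>" if F: "F \<subseteq> C" "finite F" for F
  proof -
    have "measure lebesgue (\<Union>i\<in>F. {fst i..snd i}) \<le> (\<Sum>i\<in>F. measure lebesgue {fst i..snd i})"
      using F by (intro measure_UNION_le) auto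
    also have "\<dots> \<le> (\<Sum>i\<in>F. (H (snd i) - H (fst i)) / \<alpha>)"
      using F C(2) \<open>0 < \<alpha>\<close> by (intro sum_mono) (auto simp: K_def field_simps)
    also have "\<dots> = (\<Sum>i\<in>F. H (snd i) - H (fst i)) / \<alpha>" by (simp add: sum_divide_distrib)
    also have "\<dots> \<le> (H d - H c) / \<alpha>"
    proof (intro divide_right_mono sum_increments_le[where c = c and d = d])
      show "disjnt {fst i..snd i} {fst j..snd j}" if "i \<in> F" "j \<in> F" "i \<noteq> j" for i j
        using C(3) F that unfolding pairwise_def ball by blast
    qed (use F C(2) mono \<open>0 < \<alpha>\<close> \<open>c \<le> d\<close> in \<open>auto simp: K_def\<close>)
    finally show ?thesis .
  qed
  have U: "?U \<in> lmeasurable" "measure lebesgue ?U \<le> (H d - H c) / \<alpha>"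
    using fmeasurable_UN_bound[OF C(1), of "\<lambda>i. {fst i..snd i}"] measure_UN_bound[OF C(1), of "\<lambda>i. {fst i..snd i}"] bound
    by auto
  let ?N = "S - ?U"
  have N: "negligible ?N" using C(4) by (simp add: ball)
  show ?thesis
  proof (rule that[of "?U \<union> ?N"])
    show "?U \<union> ?N \<in> lmeasurable" by (rule fmeasurable.Un[OF U(1) negligible_imp_measurable[OF N]])
    show "measure lebesgue (?U \<union> ?N) \<le> (H d - H c) / \<alpha>"
    proof -
      have "measure lebesgue (?U \<union> ?N) = measure lebesgue ?U"
        using U(1) N by (intro measure_Un_null_set) (simp_all only: negligible_iff_null_sets fmeasurableD)
      with U(2) show ?thesis by simp
    qed
  qed auto
qed

text \<open>A slope between \<open>x\<close> and a nearby point on either side is a slope over an interval with \<open>x\<close> as an end point,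
  which is the form that the covering argument takes.\<close>
lemma frequently_slope_interval:
  fixes g :: "real \<Rightarrow> real"
  assumes freq: "\<exists>\<^sub>F y in at x. P ((g y - g x) / (y - x))" and "c < x" "x < d" "0 < e"
  obtains u v where "c \<le> u" "u \<le> x" "x \<le> v" "v \<le> d" "u < v" "v - u < e" "P ((g v - g u) / (v - u))"
proof -
  have "0 < Min {e, x - c, d - x}" using assms by simp
  then obtain y where y: "y \<noteq> x" "dist y x < Min {e, x - c, d - x}" "P ((g y - g x) / (y - x))"
    using freq unfolding frequently_at by metis
  show ?thesis
  proof (cases "y < x")
    case True
    have "(g x - g y) / (x - y) = (g y - g x) / (y - x)" by (metis minus_diff_eq minus_divide_divide)
    with True y show ?thesis by (intro that[of y x]) (auto simp: dist_real_def)
  next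
    case False
    with y show ?thesis by (intro that[of x y]) (auto simp: dist_real_def)
  qed
qed

section \<open>Almost everywhere differentiability of functions of bounded variation\<close>

text \<open>Take a partition whose polygon is almost as long as the variation. In a cell where \<open>g\<close> increases, say, from end to
  end, every interval on which \<open>g\<close> falls with slope below \<open>-\<alpha>\<close> is wasted: there \<open>arc_length a g - g\<close> grows at rate at
  least \<open>\<alpha>\<close>. But the total growth of that function over the cell is the variation minus the chord, and over all cells
  this sums to the small gap between variation and polygon. Points that see both slopes see a wasted one in any cell,
  so they form a set of small outer measure.\<close>
lemma opposing_slopes_negligible:
  fixes g :: "real \<Rightarrow> real"
  assumes rect: "rectifiable a b g" and "0 < \<alpha>" "a \<le> b"
  shows "negligible {x \<in> {a<..<b}. (\<exists>\<^sub>F y in at x. \<alpha> < (g y - g x) / (y - x)) \<and>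
                                    (\<exists>\<^sub>F y in at x. (g y - g x) / (y - x) < - \<alpha>)}" (is "negligible ?E")
proof -
  define E where "E = ?E"
  have E: "a < z" "z < b" "\<exists>\<^sub>F y in at z. \<alpha> < (g y - g z) / (y - z)" "\<exists>\<^sub>F y in at z. (g y - g z) / (y - z) < - \<alpha>"
    if "z \<in> E" for z using that by (simp_all add: E_def)
  have "negligible E"
    unfolding negligible_outer_le
  proof (intro allI impI)
    fix e :: real assume "0 < e"
    define W where "W = arc_length a g"
    obtain n x where p: "is_partition a b n x" and near: "W b - \<alpha> * e < polygon_length g n x"
      using polygon_length_approaches_arc_length[OF rect \<open>a \<le> b\<close>, of "\<alpha> * e"] \<open>0 < \<alpha>\<close> \<open>0 < e\<close>
      by (auto simp: W_def)
    have x_mem: "a \<le> x i" "x i \<le> b" if "i \<le> n" for i using is_partition_bounds[OF p that] .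
    have ends: "x 0 = a" "x n = b" using p by (auto simp: is_partition_def)
    define good where "good i T \<longleftrightarrow> E \<inter> {x i<..<x (Suc i)} \<subseteq> T \<and> T \<in> lmeasurable \<and>
            measure lebesgue T \<le> (W (x (Suc i)) - W (x i) - norm (g (x (Suc i)) - g (x i))) / \<alpha>" for i T
    have "\<exists>T. good i T" if i: "i < n" for i
    proof -
      let ?c = "x i" and ?d = "x (Suc i)"
      have cd: "?c < ?d" "a \<le> ?c" "?d \<le> b" using p i x_mem[of i] x_mem[of "Suc i"] by (auto simp: is_partition_def)
      \<comment> \<open>The sign of the increment over the cell; \<open>s\<close> times the slope is then negative on wasted intervals.\<close>
      define s where "s = (if g ?c \<le> g ?d then 1 else - 1 :: real)"
      have s: "s * (g ?d - g ?c) = norm (g ?d - g ?c)" by (simp add: s_def)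
      define H where "H = (\<lambda>t. W t - s * g t)"
      have W: "norm (g v - g u) \<le> W v - W u" if "?c \<le> u" "u \<le> v" "v \<le> ?d" for u v
        unfolding W_def using that cd by (intro norm_diff_le_arc_length_diff[OF rect]) auto
      obtain T where "E \<inter> {?c<..<?d} \<subseteq> T" "T \<in> lmeasurable" "measure lebesgue T \<le> (H ?d - H ?c) / \<alpha>"
      proof (rule steep_set_outer_measure[where H = H and c = ?c and d = ?d and \<alpha> = \<alpha> and S = "E \<inter> {?c<..<?d}"])
        show "H u \<le> H v" if "?c \<le> u" "u \<le> v" "v \<le> ?d" for u v
          using W[OF that] by (auto simp: H_def s_def abs_if split: if_splits)
        show "\<exists>u v. ?c \<le> u \<and> u \<le> z \<and> z \<le> v \<and> v \<le> ?d \<and> u < v \<and> v - u < e \<and> \<alpha> * (v - u) \<le> H v - H u"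
          if z: "z \<in> E \<inter> {?c<..<?d}" and "0 < e" for z e
        proof -
          have "\<exists>\<^sub>F y in at z. s * ((g y - g z) / (y - z)) < - \<alpha>"
          proof (cases "g ?c \<le> g ?d")
            case True
            then show ?thesis using z E(4)[of z] by (simp add: s_def)
          next
            case False
            have "\<exists>\<^sub>F y in at z. \<alpha> < (g y - g z) / (y - z)" using z E(3)[of z] by simp
            moreover have "s = - 1" using False by (simp add: s_def)
            ultimately show ?thesis unfolding \<open>s = - 1\<close> mult_minus1 by (elim frequently_elim1) linarith
          qed
          then obtain u v where uv: "?c \<le> u" "u \<le> z" "z \<le> v" "v \<le> ?d" "u < v" "v - u < e"
            and "s * ((g v - g u) / (v - u)) < - \<alpha>"
            using frequently_slope_interval[where P = "\<lambda>q. s * q < - \<alpha>" and x = z and g = g and c = ?c and d = ?d and e = e] z \<open>0 < e\<close>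
            by auto
          then have "s * (g v - g u) < - \<alpha> * (v - u)" by (simp add: field_simps)
          then have "\<alpha> * (v - u) \<le> H v - H u" using W[of u v] uv by (simp add: H_def algebra_simps)
          with uv show ?thesis by blast
        qed
      qed (use cd \<open>0 < \<alpha>\<close> in auto)
      moreover have "H ?d - H ?c = W ?d - W ?c - norm (g ?d - g ?c)"
        using s by (simp add: H_def algebra_simps)
      ultimately show ?thesis by (auto simp: good_def)
    qed
    then obtain T where "\<And>i. i < n \<Longrightarrow> good i (T i)" by metis
    then have T: "\<And>i. i < n \<Longrightarrow> E \<inter> {x i<..<x (Suc i)} \<subseteq> T i" "\<And>i. i < n \<Longrightarrow> T i \<in> lmeasurable"
      "\<And>i. i < n \<Longrightarrow> measure lebesgue (T i) \<le> (W (x (Suc i)) - W (x i) - norm (g (x (Suc i)) - g (x i))) / \<alpha>"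
      by (simp_all add: good_def)
    let ?U = "\<Union>i\<in>{..<n}. T i" and ?X = "x ` {..n}"
    have U: "?U \<in> lmeasurable" using T(2) by (intro fmeasurable.finite_UN) auto
    have X: "negligible ?X" by (intro negligible_finite) auto
    have "measure lebesgue ?U \<le> (\<Sum>i<n. measure lebesgue (T i))"
      using T(2) by (intro measure_UNION_le) (auto simp: fmeasurableD)
    also have "\<dots> \<le> (\<Sum>i<n. (W (x (Suc i)) - W (x i) - norm (g (x (Suc i)) - g (x i))) / \<alpha>)"
      using T(3) by (intro sum_mono) auto
    also have "\<dots> = (W b - W a - polygon_length g n x) / \<alpha>"
      using sum_lessThan_telescope[of "\<lambda>i. W (x i)" n] ends
      by (simp add: sum_divide_distrib[symmetric] sum_subtractf polygon_length_lessThan)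
    also have "\<dots> \<le> e"
      using near \<open>0 < \<alpha>\<close> arc_length_start[of a g] by (simp add: W_def field_simps)
    finally have "measure lebesgue ?U \<le> e" .
    moreover have "measure lebesgue (?U \<union> ?X) = measure lebesgue ?U"
      using U X by (intro measure_Un_null_set) (auto simp: negligible_iff_null_sets fmeasurableD)
    moreover have "?U \<union> ?X \<in> lmeasurable" by (rule fmeasurable.Un[OF U negligible_imp_measurable[OF X]])
    moreover have "E \<subseteq> ?U \<union> ?X"
    proof
      fix t assume t: "t \<in> E"
      obtain i where "i < n" "x i \<le> t" "t < x (Suc i)"
        using is_partition_cell[OF p, of t] E[OF t] by (metis less_imp_le)
      then have "x i = t \<or> t \<in> E \<inter> {x i<..<x (Suc i)}" using t \<open>x i \<le> t\<close> \<open>t < x (Suc i)\<close> by auto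
      then have "x i = t \<or> t \<in> T i" using T(1)[OF \<open>i < n\<close>] by blast
      then show "t \<in> ?U \<union> ?X" using \<open>i < n\<close> by auto
    qed
    ultimately show "\<exists>T. E \<subseteq> T \<and> T \<in> lmeasurable \<and> measure lebesgue T \<le> e" by metis
  qed
  then show ?thesis by (simp add: E_def)
qed

text \<open>Subtracting the linear function of slope \<open>(r + s) / 2\<close> centres the two slopes around zero.\<close>
lemma oscillating_slopes_negligible:
  fixes g :: "real \<Rightarrow> real"
  assumes rect: "rectifiable a b g" and "r < s" "a \<le> b"
  shows "negligible {x \<in> {a<..<b}. (\<exists>\<^sub>F y in at x. s < (g y - g x) / (y - x)) \<and>
                                    (\<exists>\<^sub>F y in at x. (g y - g x) / (y - x) < r)}"
proof -
  define p \<alpha> where "p = (r + s) / 2" and "\<alpha> = (s - r) / 2"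
  define h where "h = (\<lambda>t. g t - p * t)"
  have slope: "(h y - h x) / (y - x) = (g y - g x) / (y - x) - p" if "y \<noteq> x" for x y
    using that by (simp add: h_def field_simps)
  have "rectifiable a b h"
  proof (rule rectifiable_if_increments_dominated[OF _ \<open>a \<le> b\<close> rect])
    fix u v :: real assume "u \<le> v"
    have "norm (h v - h u) = norm ((g v - g u) - p * (v - u))" by (simp add: h_def algebra_simps)
    also have "\<dots> \<le> norm (g v - g u) + norm (p * (v - u))" by (rule norm_triangle_ineq4)
    also have "norm (p * (v - u)) = \<bar>p\<bar> * (v - u)" using \<open>u \<le> v\<close> by (simp add: abs_mult)
    finally show "norm (h v - h u) \<le> norm (g v - g u) + \<bar>p\<bar> * (v - u)" .
  qed
  then have "negligible {x \<in> {a<..<b}. (\<exists>\<^sub>F y in at x. \<alpha> < (h y - h x) / (y - x)) \<and>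
                                    (\<exists>\<^sub>F y in at x. (h y - h x) / (y - x) < - \<alpha>)}"
    using assms by (intro opposing_slopes_negligible) (auto simp: \<alpha>_def)
  moreover have "\<alpha> < q - p \<longleftrightarrow> s < q" "q - p < - \<alpha> \<longleftrightarrow> q < r" for q
    by (auto simp: \<alpha>_def p_def field_simps)
  then have "(\<exists>\<^sub>F y in at x. \<alpha> < (h y - h x) / (y - x)) \<longleftrightarrow> (\<exists>\<^sub>F y in at x. s < (g y - g x) / (y - x))"
    "(\<exists>\<^sub>F y in at x. (h y - h x) / (y - x) < - \<alpha>) \<longleftrightarrow> (\<exists>\<^sub>F y in at x. (g y - g x) / (y - x) < r)" for x
    unfolding frequently_at by (simp_all add: slope cong: conj_cong)
  ultimately show ?thesis by simp
qed

text \<open>Steep slopes of either sign force \<open>arc_length a g\<close> to be steep.\<close>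
lemma unbounded_slopes_negligible:
  fixes g :: "real \<Rightarrow> real"
  assumes rect: "rectifiable a b g" and "a \<le> b"
  shows "negligible {x \<in> {a<..<b}. \<forall>K. \<exists>\<^sub>F y in at x. K < \<bar>(g y - g x) / (y - x)\<bar>}" (is "negligible ?E")
  unfolding negligible_outer_le
proof (intro allI impI)
  fix e :: real assume "0 < e"
  define W where "W = arc_length a g"
  have W: "norm (g v - g u) \<le> W v - W u" if "a \<le> u" "u \<le> v" "v \<le> b" for u v
    unfolding W_def using that by (intro norm_diff_le_arc_length_diff[OF rect]) auto
  \<comment> \<open>The added 1 keeps \<open>K\<close> positive when \<open>g\<close> is constant.\<close>
  define K where "K = (W b - W a + 1) / e"
  have Wab: "0 \<le> W b - W a" using W[of a b] \<open>a \<le> b\<close> norm_ge_zero[of "g b - g a"] by linarith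
  then have "0 < K" using \<open>0 < e\<close> by (simp add: K_def)
  obtain T where T: "?E \<subseteq> T" "T \<in> lmeasurable" "measure lebesgue T \<le> (W b - W a) / K"
  proof (rule steep_set_outer_measure[where H = W and c = a and d = b and \<alpha> = K and S = ?E])
    show "W u \<le> W v" if "a \<le> u" "u \<le> v" "v \<le> b" for u v
      using W[OF that] norm_ge_zero[of "g v - g u"] by linarith
    show "\<exists>u v. a \<le> u \<and> u \<le> z \<and> z \<le> v \<and> v \<le> b \<and> u < v \<and> v - u < d \<and> K * (v - u) \<le> W v - W u"
      if z: "z \<in> ?E" and "0 < d" for z d
    proof -
      from z have "\<exists>\<^sub>F y in at z. K < \<bar>(g y - g z) / (y - z)\<bar>" "a < z" "z < b" by auto
      then obtain u v where uv: "a \<le> u" "u \<le> z" "z \<le> v" "v \<le> b" "u < v" "v - u < d"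
        and K_less: "K < \<bar>(g v - g u) / (v - u)\<bar>"
        by (rule frequently_slope_interval[where P = "\<lambda>q. K < \<bar>q\<bar>", OF _ _ _ \<open>0 < d\<close>])
      from K_less \<open>u < v\<close> have "K * (v - u) \<le> norm (g v - g u)" by (simp add: pos_less_divide_eq)
      then have "K * (v - u) \<le> W v - W u" using W[of u v] uv by simp
      with uv show ?thesis by blast
    qed
  qed (use \<open>0 < K\<close> \<open>a \<le> b\<close> in auto)
  have "(W b - W a) / K \<le> e"
    using Wab \<open>0 < e\<close> by (simp add: K_def field_simps)
  with T(3) have "measure lebesgue T \<le> e" by (rule order_trans)
  with T(1,2) show "\<exists>T. ?E \<subseteq> T \<and> T \<in> lmeasurable \<and> measure lebesgue T \<le> e" by (intro exI conjI)
qed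

text \<open>If the slopes do not oscillate across a rational gap, their lower and upper limits agree; boundedness makes the
  common value finite.\<close>
lemma differentiable_from_slopes:
  fixes g :: "real \<Rightarrow> real"
  assumes bounded: "\<not> (\<forall>K. \<exists>\<^sub>F y in at x. K < \<bar>(g y - g x) / (y - x)\<bar>)"
    and no_osc: "\<And>r s. r \<in> \<rat> \<Longrightarrow> s \<in> \<rat> \<Longrightarrow> r < s \<Longrightarrow> \<not> ((\<exists>\<^sub>F y in at x. s < (g y - g x) / (y - x)) \<and>
                       (\<exists>\<^sub>F y in at x. (g y - g x) / (y - x) < r))"
  shows "g differentiable at x"
proof -
  define D where "D = (\<lambda>y. (g y - g x) / (y - x))"
  define l u where "l = Liminf (at x) (\<lambda>y. ereal (D y))" and "u = Limsup (at x) (\<lambda>y. ereal (D y))"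
  obtain K where K: "\<forall>\<^sub>F y in at x. \<bar>D y\<bar> \<le> K"
    using bounded by (auto simp: D_def frequently_def not_less)
  have "u \<le> ereal K" unfolding u_def
    by (intro Limsup_bounded eventually_mono[OF K]) auto
  moreover have "ereal (- K) \<le> l" unfolding l_def
    by (intro Liminf_bounded eventually_mono[OF K]) auto
  moreover have "l \<le> u" unfolding l_def u_def by (intro Liminf_le_Limsup) simp
  moreover have "\<not> l < u"
  proof
    assume "l < u"
    then obtain m where m: "l < ereal m" "ereal m < u" using ereal_dense2 by blast
    obtain m' where m': "ereal m < ereal m'" "ereal m' < u" using m(2) ereal_dense2 by blast
    obtain r where r: "m < real_of_rat r" "real_of_rat r < m'" using of_rat_dense m'(1) by auto
    obtain s where s: "real_of_rat r < real_of_rat s" "real_of_rat s < m'" using of_rat_dense r(2) by blast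
    have "\<exists>\<^sub>F y in at x. real_of_rat s < D y"
    proof (rule ccontr)
      assume "\<not> ?thesis"
      then have "\<forall>\<^sub>F y in at x. ereal (D y) \<le> ereal (real_of_rat s)" by (auto simp: frequently_def not_less)
      then have "u \<le> ereal (real_of_rat s)" unfolding u_def by (rule Limsup_bounded)
      then show False using m'(2) s(2) by (metis ereal_less_eq(3) leD le_less_trans less_imp_le)
    qed
    moreover have "\<exists>\<^sub>F y in at x. D y < real_of_rat r"
    proof (rule ccontr)
      assume "\<not> ?thesis"
      then have "\<forall>\<^sub>F y in at x. ereal (real_of_rat r) \<le> ereal (D y)" by (auto simp: frequently_def not_less)
      then have "ereal (real_of_rat r) \<le> l" unfolding l_def by (rule Liminf_bounded)
      then show False using m(1) r(1) by (metis ereal_less_eq(3) leD le_less_trans less_imp_le)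
    qed
    ultimately show False
      using no_osc[of "real_of_rat r" "real_of_rat s"] s(1) by (auto simp: D_def)
  qed
  ultimately have "l = u" "ereal (- K) \<le> l" "l \<le> ereal K" by auto
  then obtain q where q: "l = ereal q" by (cases l) auto
  have "((\<lambda>y. ereal (D y)) \<longlongrightarrow> l) (at x)"
    using \<open>l = u\<close> by (subst tendsto_iff_Liminf_eq_Limsup) (auto simp: l_def u_def)
  then have "(D \<longlongrightarrow> q) (at x)" by (simp add: q)
  then have "(g has_real_derivative q) (at x)"
    by (simp add: has_field_derivative_iff D_def)
  then show ?thesis by (auto simp: real_differentiable_def)
qed

text \<open>Lebesgue's theorem for functions of bounded variation. The end points are thrown into the exceptional set, so that
  two-sided derivatives can be used everywhere.\<close>
theorem rectifiable_imp_differentiable_ae: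
  fixes g :: "real \<Rightarrow> real"
  assumes "rectifiable a b g" "a \<le> b"
  shows "negligible {x \<in> {a..b}. \<not> g differentiable at x}"
proof -
  define Osc where "Osc = (\<lambda>(r, s). {x \<in> {a<..<b}. (\<exists>\<^sub>F y in at x. s < (g y - g x) / (y - x)) \<and>
                                    (\<exists>\<^sub>F y in at x. (g y - g x) / (y - x) < r)})"
  define Inf where "Inf = {x \<in> {a<..<b}. \<forall>K. \<exists>\<^sub>F y in at x. K < \<bar>(g y - g x) / (y - x)\<bar>}"
  define Q where "Q = {(r, s). r \<in> \<rat> \<and> s \<in> \<rat> \<and> r < (s::real)}"
  have "Q \<subseteq> \<rat> \<times> \<rat>" by (auto simp: Q_def)
  then have "countable Q" by (rule countable_subset) (simp add: countable_rat)
  moreover have "negligible (Osc p)" if "p \<in> Q" for p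
    using that oscillating_slopes_negligible[OF assms(1) _ assms(2)] by (cases p) (simp add: Osc_def Q_def)
  ultimately have "negligible (\<Union>p\<in>Q. Osc p)"
    by (intro negligible_countable_Union countable_image) blast+
  moreover have "negligible Inf" unfolding Inf_def by (intro unbounded_slopes_negligible assms)
  ultimately have "negligible ({a, b} \<union> Inf \<union> (\<Union>p\<in>Q. Osc p))"
    by (intro negligible_Un) simp_all
  moreover have "x \<in> {a, b} \<union> Inf \<union> (\<Union>p\<in>Q. Osc p)" if x: "x \<in> {a..b}" "\<not> g differentiable at x" for x
  proof (rule ccontr)
    assume n: "\<not> ?thesis"
    then have "x \<in> {a<..<b}" using x by auto
    moreover have "x \<notin> Inf" "\<And>p. p \<in> Q \<Longrightarrow> x \<notin> Osc p" using n by auto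
    ultimately have "g differentiable at x"
      by (intro differentiable_from_slopes) (auto simp: Inf_def Osc_def Q_def)
    with x show False by simp
  qed
  ultimately show ?thesis by (elim negligible_subset) blast
qed

section \<open>The integral of the speed is at most the length\<close>

text \<open>The point \<open>x\<close> need not be an end point of the intervals: the linear approximation errors at the two ends are
  proportional to distances that add up to the length of the interval.\<close>
lemma straddling_difference_quotients_tendsto:
  fixes f :: "real \<Rightarrow> 'a::real_normed_vector"
  assumes D: "(f has_vector_derivative D) (at x)"
    and uv: "\<And>n. u n \<le> x" "\<And>n. x \<le> v n" "\<And>n. u n < v n" and lim: "(\<lambda>n. v n - u n) \<longlonglongrightarrow> 0"
  shows "(\<lambda>n. (f (v n) - f (u n)) /\<^sub>R (v n - u n)) \<longlonglongrightarrow> D"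
proof (rule metric_LIMSEQ_I)
  fix e :: real assume "0 < e"
  then obtain d where d: "0 < d" "\<And>y. norm (y - x) < d \<Longrightarrow> norm (f y - f x - (y - x) *\<^sub>R D) \<le> e / 2 * norm (y - x)"
    using D unfolding has_vector_derivative_def has_derivative_at_alt by (meson half_gt_zero)
  obtain N where N: "\<And>n. n \<ge> N \<Longrightarrow> v n - u n < d"
    using metric_LIMSEQ_D[OF lim d(1)] by (fastforce simp: dist_real_def abs_less_iff)
  have "dist ((f (v n) - f (u n)) /\<^sub>R (v n - u n)) D < e" if "n \<ge> N" for n
  proof -
    let ?h = "v n - u n"
    have h: "0 < ?h" using uv(3)[of n] by simp
    have "norm (f (v n) - f (u n) - ?h *\<^sub>R D) = norm ((f (v n) - f x - (v n - x) *\<^sub>R D) - (f (u n) - f x - (u n - x) *\<^sub>R D))"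
      by (simp add: algebra_simps)
    also have "\<dots> \<le> norm (f (v n) - f x - (v n - x) *\<^sub>R D) + norm (f (u n) - f x - (u n - x) *\<^sub>R D)"
      by (rule norm_triangle_ineq4)
    also have "\<dots> \<le> e / 2 * norm (v n - x) + e / 2 * norm (u n - x)"
      using uv(1-3)[of n] N[OF that] by (intro add_mono d(2)) auto
    also have "\<dots> = e / 2 * ?h" using uv(1-2)[of n] by (simp add: field_simps)
    finally have *: "norm (f (v n) - f (u n) - ?h *\<^sub>R D) \<le> e / 2 * ?h" .
    have "(f (v n) - f (u n)) /\<^sub>R ?h - D = (f (v n) - f (u n) - ?h *\<^sub>R D) /\<^sub>R ?h"
      using h by (simp add: scaleR_diff_right)
    then have "dist ((f (v n) - f (u n)) /\<^sub>R ?h) D = norm (f (v n) - f (u n) - ?h *\<^sub>R D) / ?h"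
      using h by (simp add: dist_norm divide_inverse mult.commute)
    also have "\<dots> \<le> e / 2" using * h by (simp add: pos_divide_le_eq)
    finally show ?thesis using \<open>0 < e\<close> by simp
  qed
  then show "\<exists>N. \<forall>n\<ge>N. dist ((f (v n) - f (u n)) /\<^sub>R (v n - u n)) D < e" by blast
qed

text \<open>The speed of the polygon inscribed along the partition. The cells are half-open, so that each point before the
  last one lies in exactly one of them.\<close>
definition chord_speed :: "(real \<Rightarrow> 'a::real_normed_vector) \<Rightarrow> nat \<Rightarrow> (nat \<Rightarrow> real) \<Rightarrow> real \<Rightarrow> real" where
  "chord_speed f n x t =
     (\<Sum>i<n. norm (f (x (Suc i)) - f (x i)) / (x (Suc i) - x i) * indicator {x i..<x (Suc i)} t)"

lemma chord_speed_measurable [measurable]: "chord_speed f n x \<in> borel_measurable lebesgue"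
  unfolding chord_speed_def
  by (intro borel_measurable_sum borel_measurable_times borel_measurable_const borel_measurable_indicator) auto

lemma chord_speed_eq:
  assumes "i < n" "t \<in> {x i..<x (Suc i)}" "\<And>j. j < n \<Longrightarrow> j \<noteq> i \<Longrightarrow> t \<notin> {x j..<x (Suc j)}"
  shows "chord_speed f n x t = norm (f (x (Suc i)) - f (x i)) / (x (Suc i) - x i)"
proof -
  have "chord_speed f n x t = (\<Sum>j\<in>{i}. norm (f (x (Suc j)) - f (x j)) / (x (Suc j) - x j) * indicator {x j..<x (Suc j)} t)"
    unfolding chord_speed_def using assms(1,3) by (intro sum.mono_neutral_right) auto
  then show ?thesis using assms(2) by simp
qed

lemma nn_integral_chord_speed:
  assumes p: "is_partition a b n x"
  shows "(\<integral>\<^sup>+t. ennreal (chord_speed f n x t) \<partial>lebesgue) = ennreal (polygon_length f n x)"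
proof -
  have lt: "x i < x (Suc i)" if "i < n" for i using p that by (simp add: is_partition_def)
  let ?c = "\<lambda>i. norm (f (x (Suc i)) - f (x i)) / (x (Suc i) - x i)"
  have c: "0 \<le> ?c i" if "i < n" for i using lt[OF that] by simp
  have "ennreal (chord_speed f n x t) = (\<Sum>i<n. ennreal (?c i) * indicator {x i..<x (Suc i)} t)" for t
  proof -
    have "ennreal (chord_speed f n x t) = (\<Sum>i<n. ennreal (?c i * indicator {x i..<x (Suc i)} t))"
      unfolding chord_speed_def using c by (intro sum_ennreal[symmetric] mult_nonneg_nonneg) auto
    also have "\<dots> = (\<Sum>i<n. ennreal (?c i) * indicator {x i..<x (Suc i)} t)"
      by (intro sum.cong refl) (simp split: split_indicator)
    finally show ?thesis .
  qed
  then have "(\<integral>\<^sup>+t. ennreal (chord_speed f n x t) \<partial>lebesgue) =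
      (\<Sum>i<n. \<integral>\<^sup>+t. ennreal (?c i) * indicator {x i..<x (Suc i)} t \<partial>lebesgue)"
    by (simp only:) (intro nn_integral_sum borel_measurable_times_ennreal borel_measurable_const borel_measurable_indicator, simp)
  also have "\<dots> = (\<Sum>i<n. ennreal (norm (f (x (Suc i)) - f (x i))))"
  proof (intro sum.cong refl)
    fix i assume "i \<in> {..<n}"
    then have i: "i < n" by simp
    have "(\<integral>\<^sup>+t. ennreal (?c i) * indicator {x i..<x (Suc i)} t \<partial>lebesgue) = ennreal (?c i) * ennreal (x (Suc i) - x i)"
      using lt[OF i] by (subst nn_integral_cmult_indicator) auto
    also have "\<dots> = ennreal (norm (f (x (Suc i)) - f (x i)))"
      using lt[OF i] by (subst ennreal_mult''[symmetric]) auto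
    finally show "(\<integral>\<^sup>+t. ennreal (?c i) * indicator {x i..<x (Suc i)} t \<partial>lebesgue) = \<dots>" .
  qed
  also have "\<dots> = ennreal (polygon_length f n x)" by (simp add: polygon_length_lessThan)
  finally show ?thesis .
qed

definition uniform_partition :: "real \<Rightarrow> real \<Rightarrow> nat \<Rightarrow> nat \<Rightarrow> real" where
  "uniform_partition a b n i = a + real i * ((b - a) / real n)"

lemma is_partition_uniform:
  assumes "a < b" "0 < n"
  shows "is_partition a b n (uniform_partition a b n)"
  using assms by (auto simp: is_partition_def uniform_partition_def field_simps)

lemma chord_speed_uniform_tendsto:
  fixes f :: "real \<Rightarrow> 'a::real_normed_vector"
  assumes "a < b" "a \<le> t" "t < b" and D: "(f has_vector_derivative D) (at t)"
  shows "(\<lambda>n. chord_speed f (Suc n) (uniform_partition a b (Suc n)) t) \<longlonglongrightarrow> norm D"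
proof -
  let ?x = "\<lambda>n. uniform_partition a b (Suc n)"
  have "\<exists>i. i < Suc n \<and> ?x n i \<le> t \<and> t < ?x n (Suc i) \<and>
          (\<forall>j. j < Suc n \<longrightarrow> j \<noteq> i \<longrightarrow> t \<notin> {?x n j..<?x n (Suc j)})" for n
    using is_partition_cell[OF is_partition_uniform[OF \<open>a < b\<close> zero_less_Suc] assms(2,3)] by metis
  then obtain i where i: "\<And>n. i n < Suc n" "\<And>n. ?x n (i n) \<le> t" "\<And>n. t < ?x n (Suc (i n))"
      "\<And>n j. j < Suc n \<Longrightarrow> j \<noteq> i n \<Longrightarrow> t \<notin> {?x n j..<?x n (Suc j)}"
    by metis
  define u v where "u n = ?x n (i n)" and "v n = ?x n (Suc (i n))" for n
  have width: "v n - u n = (b - a) / real (Suc n)" for n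
    by (simp add: u_def v_def uniform_partition_def algebra_simps add_divide_distrib diff_divide_distrib)
  have "(\<lambda>n. (f (v n) - f (u n)) /\<^sub>R (v n - u n)) \<longlonglongrightarrow> D"
  proof (rule straddling_difference_quotients_tendsto[OF D])
    show "u n \<le> t" "t \<le> v n" "u n < v n" for n using i(2)[of n] i(3)[of n] by (auto simp: u_def v_def)
    show "(\<lambda>n. v n - u n) \<longlonglongrightarrow> 0" unfolding width
      using tendsto_mult_right_zero[OF LIMSEQ_inverse_real_of_nat, of "b - a"] by (simp add: divide_inverse)
  qed
  then have "(\<lambda>n. norm ((f (v n) - f (u n)) /\<^sub>R (v n - u n))) \<longlonglongrightarrow> norm D" by (rule tendsto_norm)
  moreover have "chord_speed f (Suc n) (?x n) t = norm ((f (v n) - f (u n)) /\<^sub>R (v n - u n))" for n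
    using i(2,3)[of n] chord_speed_eq[of "i n" "Suc n" t "?x n" f, OF i(1)] i(4)[of _ n]
    by (simp add: u_def v_def divide_inverse mult.commute)
  ultimately show ?thesis by simp
qed

lemma AE_lebesgue_neq: "AE x in lebesgue. x \<noteq> (c::real)"
  using negligible_sing[of c] by (intro AE_I'[of "{c}"]) (auto simp: negligible_iff_null_sets)

text \<open>Along uniform partitions the chord speeds converge almost everywhere to the norm of the derivative, and their
  integrals are polygon lengths, so Fatou's lemma gives the inequality. Measurability of the speed comes from the same
  limit; it holds although \<open>D\<close> is arbitrary on a null set because Lebesgue measure is complete.\<close>
lemma
  fixes f :: "real \<Rightarrow> 'a::real_normed_vector"
  assumes "a < b" and D: "AE x in lebesgue. x \<in> {a..b} \<longrightarrow> (f has_vector_derivative D x) (at x)"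
  shows speed_measurable: "(\<lambda>x. norm (D x) * indicator {a..b} x) \<in> borel_measurable lebesgue" (is ?meas)
    and nn_integral_speed_le_curve_length:
      "(\<integral>\<^sup>+x\<in>{a..b}. ennreal (norm (D x)) \<partial>lebesgue) \<le> curve_length a b f" (is ?le)
proof -
  define s where "s n = chord_speed f (Suc n) (uniform_partition a b (Suc n))" for n
  define L where "L x = liminf (\<lambda>n. ennreal (s n x))" for x
  have s_meas [measurable]: "s n \<in> borel_measurable lebesgue" for n unfolding s_def by measurable
  have L_meas [measurable]: "L \<in> borel_measurable lebesgue" unfolding L_def by measurable
  have *: "AE x in lebesgue. L x = ennreal (norm (D x) * indicator {a..b} x)"
    using D AE_lebesgue_neq[of b]
  proof eventually_elim
    case (elim x)
    have "(\<lambda>n. s n x) \<longlonglongrightarrow> norm (D x) * indicator {a..b} x"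
    proof (cases "x \<in> {a..<b}")
      case True
      with elim show ?thesis unfolding s_def
        using chord_speed_uniform_tendsto[OF \<open>a < b\<close>, of x f "D x"] by auto
    next
      case False
      have "s n x = 0" for n
        unfolding s_def chord_speed_def
      proof (rule sum.neutral, rule ballI)
        fix i assume "i \<in> {..<Suc n}"
        then have "a \<le> uniform_partition a b (Suc n) i" "uniform_partition a b (Suc n) (Suc i) \<le> b"
          using is_partition_bounds[OF is_partition_uniform[OF \<open>a < b\<close> zero_less_Suc[of n]]] by (auto simp: less_Suc_eq_le)
        then have "x \<notin> {uniform_partition a b (Suc n) i..<uniform_partition a b (Suc n) (Suc i)}"
          using False by auto
        then show "norm (f (uniform_partition a b (Suc n) (Suc i)) - f (uniform_partition a b (Suc n) i)) /
            (uniform_partition a b (Suc n) (Suc i) - uniform_partition a b (Suc n) i) *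
            indicator {uniform_partition a b (Suc n) i..<uniform_partition a b (Suc n) (Suc i)} x = 0"
          by simp
      qed
      then show ?thesis using False elim by auto
    qed
    then have "(\<lambda>n. ennreal (s n x)) \<longlonglongrightarrow> ennreal (norm (D x) * indicator {a..b} x)" by (rule tendsto_ennrealI)
    then show ?case unfolding L_def by (intro lim_imp_Liminf) auto
  qed
  show ?meas
  proof (rule borel_measurable_AE)
    show "(\<lambda>x. enn2real (L x)) \<in> borel_measurable lebesgue" by measurable
    show "AE x in lebesgue. enn2real (L x) = norm (D x) * indicator {a..b} x"
      using * by eventually_elim simp
  qed
  have "(\<integral>\<^sup>+x\<in>{a..b}. ennreal (norm (D x)) \<partial>lebesgue) = (\<integral>\<^sup>+x. L x \<partial>lebesgue)"
    using * by (intro nn_integral_cong_AE; eventually_elim) (auto split: split_indicator)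
  also have "\<dots> \<le> liminf (\<lambda>n. \<integral>\<^sup>+x. ennreal (s n x) \<partial>lebesgue)"
    unfolding L_def by (intro nn_integral_liminf) measurable
  also have "\<dots> \<le> liminf (\<lambda>n. curve_length a b f)"
  proof (intro Liminf_mono always_eventually allI)
    fix n
    have p: "is_partition a b (Suc n) (uniform_partition a b (Suc n))"
      by (rule is_partition_uniform[OF \<open>a < b\<close> zero_less_Suc])
    show "(\<integral>\<^sup>+x. ennreal (s n x) \<partial>lebesgue) \<le> curve_length a b f"
      unfolding s_def nn_integral_chord_speed[OF p] by (rule polygon_length_le_curve_length[OF p])
  qed
  also have "\<dots> = curve_length a b f" by (intro Liminf_const) simp
  finally show ?le .
qed

section \<open>Absolute continuity of functions and of integrals\<close>

lemma absolutely_continuous_onE: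
  assumes "absolutely_continuous_on a b g" "0 < e"
  obtains \<delta> where "0 < \<delta>"
    "\<And>(n::nat) u v. (\<And>i. i < n \<Longrightarrow> a \<le> u i \<and> u i < v i \<and> v i \<le> b) \<Longrightarrow>
       disjoint_family_on (\<lambda>i. {u i<..<v i}) {..<n} \<Longrightarrow> (\<Sum>i<n. v i - u i) < \<delta> \<Longrightarrow>
       (\<Sum>i<n. \<bar>g (v i) - g (u i)\<bar>) < e"
proof -
  note ex = assms(1)[unfolded absolutely_continuous_on_def, rule_format, OF assms(2)]
  show ?thesis
    using ex by (elim exE conjE) (rule that, assumption, simp)
qed

text \<open>Families indexed by an arbitrary finite set, such as the cells of a tagged division, in place of initial segments
  of the natural numbers.\<close>
lemma absolutely_continuous_on_finite:
  assumes "absolutely_continuous_on a b g" "0 < e"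
  shows "\<exists>\<delta>>0. \<forall>(I :: 'i set) u v. finite I \<longrightarrow> (\<forall>i\<in>I. a \<le> u i \<and> u i < v i \<and> v i \<le> b) \<longrightarrow>
       disjoint_family_on (\<lambda>i. {u i<..<v i}) I \<longrightarrow> (\<Sum>i\<in>I. v i - u i) < \<delta> \<longrightarrow>
       (\<Sum>i\<in>I. \<bar>g (v i) - g (u i)\<bar>) < e"
proof -
  obtain \<delta> where \<delta>: "0 < \<delta>" "\<And>(n::nat) u v. (\<And>i. i < n \<Longrightarrow> a \<le> u i \<and> u i < v i \<and> v i \<le> b) \<Longrightarrow>
        disjoint_family_on (\<lambda>i. {u i<..<v i}) {..<n} \<Longrightarrow>
        (\<Sum>i<n. v i - u i) < \<delta> \<Longrightarrow> (\<Sum>i<n. \<bar>g (v i) - g (u i)\<bar>) < e"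
    by (rule absolutely_continuous_onE[OF assms]) (rule that, assumption, simp)
  show ?thesis
  proof (intro exI[of _ \<delta>] conjI allI impI \<delta>(1))
    fix I :: "'i set" and u v
    assume I: "finite I" "\<forall>i\<in>I. a \<le> u i \<and> u i < v i \<and> v i \<le> b"
      "disjoint_family_on (\<lambda>i. {u i<..<v i}) I" "(\<Sum>i\<in>I. v i - u i) < \<delta>"
    obtain h where h: "bij_betw h {..<card I} I"
      using ex_bij_betw_nat_finite[OF I(1)] by (auto simp: atLeast0LessThan)
    then have mem: "h i \<in> I" if "i < card I" for i using that by (auto simp: bij_betw_def)
    have "(\<Sum>i<card I. \<bar>g (v (h i)) - g (u (h i))\<bar>) < e"
    proof (rule \<delta>(2))
      show "a \<le> u (h i) \<and> u (h i) < v (h i) \<and> v (h i) \<le> b" if "i < card I" for i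
        using I(2) mem that by blast
      show "disjoint_family_on (\<lambda>i. {u (h i)<..<v (h i)}) {..<card I}"
        unfolding disjoint_family_on_def
      proof (intro ballI impI)
        fix i j assume "i \<in> {..<card I}" "j \<in> {..<card I}" "i \<noteq> j"
        then have "h i \<in> I" "h j \<in> I" "h i \<noteq> h j" using h mem by (auto simp: bij_betw_def inj_on_def)
        then show "{u (h i)<..<v (h i)} \<inter> {u (h j)<..<v (h j)} = {}"
          using I(3) unfolding disjoint_family_on_def by blast
      qed
      show "(\<Sum>i<card I. v (h i) - u (h i)) < \<delta>"
        using I(4) by (simp only: sum.reindex_bij_betw[OF h, of "\<lambda>i. v i - u i"])
    qed
    then show "(\<Sum>i\<in>I. \<bar>g (v i) - g (u i)\<bar>) < e"
      by (simp only: sum.reindex_bij_betw[OF h, of "\<lambda>i. \<bar>g (v i) - g (u i)\<bar>"])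
  qed
qed

lemma absolutely_continuous_on_subinterval:
  assumes ac: "absolutely_continuous_on a b g" and sub: "a \<le> c" "d \<le> b"
  shows "absolutely_continuous_on c d g"
  unfolding absolutely_continuous_on_def
proof (intro allI impI)
  fix e :: real assume "0 < e"
  obtain \<delta> where \<delta>: "0 < \<delta>" "\<And>(n::nat) u v. (\<And>i. i < n \<Longrightarrow> a \<le> u i \<and> u i < v i \<and> v i \<le> b) \<Longrightarrow>
        disjoint_family_on (\<lambda>i. {u i<..<v i}) {..<n} \<Longrightarrow>
        (\<Sum>i<n. v i - u i) < \<delta> \<Longrightarrow> (\<Sum>i<n. \<bar>g (v i) - g (u i)\<bar>) < e"
    by (rule absolutely_continuous_onE[OF ac \<open>0 < e\<close>]) (rule that, assumption, simp)
  have sub': "a \<le> s \<and> s < t \<and> t \<le> b" if "c \<le> s \<and> s < t \<and> t \<le> d" for s t using that sub by auto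
  show "\<exists>\<delta>>0. \<forall>(n::nat) u v. (\<forall>i<n. c \<le> u i \<and> u i < v i \<and> v i \<le> d) \<longrightarrow>
        disjoint_family_on (\<lambda>i. {u i<..<v i}) {..<n} \<longrightarrow>
        (\<Sum>i<n. v i - u i) < \<delta> \<longrightarrow> (\<Sum>i<n. \<bar>g (v i) - g (u i)\<bar>) < e"
  proof (intro exI[of _ \<delta>] conjI allI impI \<delta>(1))
    fix n :: nat and u v
    assume uv: "\<forall>i<n. c \<le> u i \<and> u i < v i \<and> v i \<le> d" and "disjoint_family_on (\<lambda>i. {u i<..<v i}) {..<n}"
      "(\<Sum>i<n. v i - u i) < \<delta>"
    moreover have "a \<le> u i \<and> u i < v i \<and> v i \<le> b" if "i < n" for i using uv that sub' by blast
    ultimately show "(\<Sum>i<n. \<bar>g (v i) - g (u i)\<bar>) < e" by (intro \<delta>(2))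
  qed
qed

text \<open>The fundamental theorem of calculus, proved with a gauge. Off the null set \<open>N\<close> the gauge is the one that makes the
  linear approximation good, as for an everywhere differentiable function. On \<open>N\<close> the gauge is an open superset of \<open>N\<close>
  of measure below the \<open>\<delta>\<close> of absolute continuity: the cells tagged in \<open>N\<close> are disjoint intervals inside it, so
  together they contribute little to the increment of \<open>g\<close>, while the integrand is set to zero there.\<close>
theorem absolutely_continuous_has_integral:
  fixes g g' :: "real \<Rightarrow> real"
  assumes ac: "absolutely_continuous_on a b g" and "a \<le> b" and N: "negligible N"
    and D: "\<And>x. x \<in> {a..b} - N \<Longrightarrow> (g has_vector_derivative g' x) (at x within {a..b})"
  shows "(g' has_integral (g b - g a)) {a..b}"
proof -
  define g0 where "g0 x = (if x \<in> N then 0 else g' x)" for x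
  have "(g0 has_integral (g b - g a)) {a..b}"
    unfolding has_integral_real
  proof (intro allI impI)
    fix e :: real assume "0 < e"
    define \<epsilon> where "\<epsilon> = e / (2 * (b - a + 1))"
    have \<epsilon>: "0 < \<epsilon>" "\<epsilon> * (b - a) < e / 2"
      using \<open>0 < e\<close> \<open>a \<le> b\<close> by (simp_all add: \<epsilon>_def field_simps)
    have "\<exists>d>0. x \<in> {a..b} - N \<longrightarrow>
         (\<forall>y\<in>{a..b}. norm (y - x) < d \<longrightarrow> norm (g y - g x - (y - x) *\<^sub>R g' x) \<le> \<epsilon> * norm (y - x))" for x
      using D[of x, unfolded has_vector_derivative_def has_derivative_within_alt] \<epsilon>(1)
      by (cases "x \<in> {a..b} - N") (blast, meson zero_less_one)
    then obtain d where d: "\<And>x. 0 < d x"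
      "\<And>x y. x \<in> {a..b} - N \<Longrightarrow> y \<in> {a..b} \<Longrightarrow> norm (y - x) < d x \<Longrightarrow>
          norm (g y - g x - (y - x) *\<^sub>R g' x) \<le> \<epsilon> * norm (y - x)"
      by metis
    obtain \<delta> where \<delta>: "0 < \<delta>"
      and ac\<delta>: "\<forall>(I :: (real \<times> real set) set) u v. finite I \<longrightarrow>
         (\<forall>i\<in>I. a \<le> u i \<and> u i < v i \<and> v i \<le> b) \<longrightarrow>
         disjoint_family_on (\<lambda>i. {u i<..<v i}) I \<longrightarrow> (\<Sum>i\<in>I. v i - u i) < \<delta> \<longrightarrow>
         (\<Sum>i\<in>I. \<bar>g (v i) - g (u i)\<bar>) < e / 2"
      using absolutely_continuous_on_finite[OF ac half_gt_zero[OF \<open>0 < e\<close>]] by blast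
    have Nl: "N \<in> null_sets lebesgue" using N by (simp add: negligible_iff_null_sets)
    obtain T where T: "open T" "N \<subseteq> T" "T - N \<in> lmeasurable" "emeasure lebesgue (T - N) < ennreal \<delta>"
      using sets_lebesgue_outer_open[OF _ \<delta>, of N] Nl by auto
    have "T = (T - N) \<union> N" using T(2) by auto
    then have T_meas: "T \<in> lmeasurable"
      using fmeasurable.Un[OF T(3) negligible_imp_measurable[OF N]] by simp
    have "emeasure lebesgue T < ennreal \<delta>"
      using emeasure_Un_null_set[of "T - N" lebesgue N] T(3,4) Nl \<open>T = (T - N) \<union> N\<close> by (simp add: fmeasurableD)
    then have T_small: "measure lebesgue T < \<delta>"
      using T_meas \<delta> by (simp add: emeasure_eq_measure2 ennreal_less_iff)
    define \<gamma> where "\<gamma> x = (if x \<in> N then T else ball x (d x))" for x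
    have gauge: "gauge \<gamma>" using T(1,2) d(1) by (auto simp: gauge_def \<gamma>_def)
    have Riemann_sum: "norm ((\<Sum>(x, K)\<in>p. measure lborel K *\<^sub>R g0 x) - (g b - g a)) < e"
      if p: "p tagged_division_of {a..b}" and fine: "\<gamma> fine p" for p
    proof -
      have fin: "finite p" using p by auto
      have cell: "\<exists>u v. K = {u..v} \<and> u \<le> x \<and> x \<le> v \<and> a \<le> u \<and> v \<le> b \<and> {u..v} \<subseteq> \<gamma> x \<and>
           Inf K = u \<and> Sup K = v \<and> measure lborel K = v - u" if xK: "(x, K) \<in> p" for x K
      proof -
        have "x \<in> K" "K \<subseteq> {a..b}" "\<exists>u v. K = cbox u v" using tagged_division_ofD(2-4)[OF p xK] by auto
        then obtain u v where "K = {u..v}" "u \<le> x" "x \<le> v" by auto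
        moreover have "K \<subseteq> \<gamma> x" using fine xK by (auto simp: fine_def)
        ultimately show ?thesis using \<open>K \<subseteq> {a..b}\<close> by (intro exI[of _ u] exI[of _ v]) auto
      qed
      define F where "F = (\<lambda>(x, K). measure lborel K *\<^sub>R g0 x - (g (Sup K) - g (Inf K)))"
      \<comment> \<open>Degenerate cells tagged in \<open>N\<close> contribute nothing and are left out of \<open>Q\<close>, since absolute continuity
        speaks of nondegenerate intervals.\<close>
      define P Q where "P = {i \<in> p. fst i \<notin> N}" and "Q = {i \<in> p. fst i \<in> N \<and> Inf (snd i) < Sup (snd i)}"
      have "(\<Sum>(x, K)\<in>p. measure lborel K *\<^sub>R g0 x) - (g b - g a) = sum F p"
        using additive_tagged_division_1[OF \<open>a \<le> b\<close> p, of g]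
        by (simp add: F_def split_def sum_subtractf)
      also have "\<dots> = sum F (P \<union> Q)"
      proof (rule sum.mono_neutral_right[OF fin])
        show "\<forall>i\<in>p - (P \<union> Q). F i = 0"
        proof
          fix i assume i: "i \<in> p - (P \<union> Q)"
          obtain x K where xK: "i = (x, K)" by (cases i)
          then obtain u v where "Inf K = u" "Sup K = v" "u \<le> v" "measure lborel K = v - u"
            using cell[of x K] i by force
          then show "F i = 0" using i xK by (auto simp: F_def P_def Q_def)
        qed
      qed (auto simp: P_def Q_def)
      also have "\<dots> = sum F P + sum F Q"
        using fin by (intro sum.union_disjoint) (auto simp: P_def Q_def)
      finally have split: "(\<Sum>(x, K)\<in>p. measure lborel K *\<^sub>R g0 x) - (g b - g a) = sum F P + sum F Q" .
      have "norm (sum F P) \<le> (\<Sum>i\<in>P. \<epsilon> * measure lborel (snd i))"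
      proof (rule sum_norm_le)
        fix i assume i: "i \<in> P"
        obtain x K where xK: "i = (x, K)" by (cases i)
        then have mem: "(x, K) \<in> p" "x \<notin> N" using i by (auto simp: P_def)
        then obtain u v where K: "K = {u..v}" "u \<le> x" "x \<le> v" "a \<le> u" "v \<le> b" "{u..v} \<subseteq> \<gamma> x"
          "Inf K = u" "Sup K = v" "measure lborel K = v - u" using cell by blast
        have "u \<in> {u..v}" "v \<in> {u..v}" using K(2,3) by auto
        then have "u \<in> ball x (d x)" "v \<in> ball x (d x)" using K(6) mem(2) by (auto simp: \<gamma>_def)
        then have du: "norm (u - x) < d x" and dv: "norm (v - x) < d x" by (auto simp: dist_real_def)
        have "F i = (g u - g x - (u - x) *\<^sub>R g' x) - (g v - g x - (v - x) *\<^sub>R g' x)"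
          using mem(2) by (simp add: F_def xK K(7-9) g0_def algebra_simps)
        also have "norm \<dots> \<le> norm (g u - g x - (u - x) *\<^sub>R g' x) + norm (g v - g x - (v - x) *\<^sub>R g' x)"
          by (rule norm_triangle_ineq4)
        also have "\<dots> \<le> \<epsilon> * norm (u - x) + \<epsilon> * norm (v - x)"
          using K(2-5) mem(2) du dv by (intro add_mono d(2)) auto
        also have "\<dots> = \<epsilon> * measure lborel (snd i)"
          using K(2,3) by (simp add: xK K(9) algebra_simps)
        finally show "norm (F i) \<le> \<epsilon> * measure lborel (snd i)" .
      qed
      also have "\<dots> \<le> (\<Sum>i\<in>p. \<epsilon> * measure lborel (snd i))"
        using \<epsilon>(1) fin by (intro sum_mono2) (auto simp: P_def)
      also have "\<dots> = \<epsilon> * (\<Sum>(x, K)\<in>p. measure lborel K)" by (simp add: sum_distrib_left split_def)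
      also have "(\<Sum>(x, K)\<in>p. measure lborel K) = b - a"
        using additive_content_tagged_division[of p a b] p \<open>a \<le> b\<close> by simp
      finally have *: "norm (sum F P) \<le> \<epsilon> * (b - a)" .
      have Q: "finite Q" using fin by (simp add: Q_def)
      have Qcell: "a \<le> Inf (snd i) \<and> Inf (snd i) < Sup (snd i) \<and> Sup (snd i) \<le> b \<and>
          {Inf (snd i)<..<Sup (snd i)} = interior (snd i) \<and> {Inf (snd i)<..<Sup (snd i)} \<subseteq> T" if "i \<in> Q" for i
      proof -
        obtain x K where xK: "i = (x, K)" by (cases i)
        then have mem: "(x, K) \<in> p" "x \<in> N" "Inf K < Sup K" using that by (auto simp: Q_def)
        then obtain u v where K: "K = {u..v}" "a \<le> u" "v \<le> b" "{u..v} \<subseteq> \<gamma> x"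
          "Inf K = u" "Sup K = v" using cell by blast
        moreover have "{u<..<v} \<subseteq> T" using K(4) mem(2) by (auto simp: \<gamma>_def subset_eq)
        ultimately show ?thesis using mem(3) by (simp add: xK)
      qed
      have disj: "disjoint_family_on (\<lambda>i. {Inf (snd i)<..<Sup (snd i)}) Q"
        unfolding disjoint_family_on_def
      proof (intro ballI impI)
        fix i j assume ij: "i \<in> Q" "j \<in> Q" "i \<noteq> j"
        then have "interior (snd i) \<inter> interior (snd j) = {}"
          using tagged_division_ofD(5)[OF p, of "fst i" "snd i" "fst j" "snd j"] by (auto simp: Q_def)
        then show "{Inf (snd i)<..<Sup (snd i)} \<inter> {Inf (snd j)<..<Sup (snd j)} = {}"
          using Qcell[OF ij(1)] Qcell[OF ij(2)] by simp
      qed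
      have "(\<Sum>i\<in>Q. Sup (snd i) - Inf (snd i)) = (\<Sum>i\<in>Q. measure lebesgue {Inf (snd i)<..<Sup (snd i)})"
      proof (intro sum.cong refl)
        fix i assume "i \<in> Q"
        then have "Inf (snd i) \<le> Sup (snd i)" using Qcell by (simp add: less_imp_le)
        then show "Sup (snd i) - Inf (snd i) = measure lebesgue {Inf (snd i)<..<Sup (snd i)}" by simp
      qed
      also have "\<dots> = measure lebesgue (\<Union>i\<in>Q. {Inf (snd i)<..<Sup (snd i)})"
        using disj Q by (intro measure_UNION'[symmetric]) (auto simp: disjoint_family_on_def pairwise_def disjnt_def)
      also have "\<dots> \<le> measure lebesgue T"
        using Qcell T_meas Q by (intro measure_mono_fmeasurable) auto
      finally have "(\<Sum>i\<in>Q. \<bar>g (Sup (snd i)) - g (Inf (snd i))\<bar>) < e / 2"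
        using Qcell T_small Q disj by (intro ac\<delta>[rule_format]) auto
      moreover have "norm (sum F Q) \<le> (\<Sum>i\<in>Q. \<bar>g (Sup (snd i)) - g (Inf (snd i))\<bar>)"
        by (rule sum_norm_le) (auto simp: F_def Q_def g0_def split_def)
      ultimately have "norm (sum F Q) < e / 2" by simp
      then have "norm (sum F P + sum F Q) < e"
        using * \<epsilon>(2) norm_triangle_ineq[of "sum F P" "sum F Q"] by linarith
      then show ?thesis by (simp only: split)
    qed
    show "\<exists>\<gamma>. gauge \<gamma> \<and> (\<forall>p. p tagged_division_of {a..b} \<and> \<gamma> fine p \<longrightarrow>
        norm ((\<Sum>(x, K)\<in>p. measure lborel K *\<^sub>R g0 x) - (g b - g a)) < e)"
      by (intro exI[of _ \<gamma>] conjI allI impI gauge Riemann_sum; elim conjE)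
  qed
  then show ?thesis
    by (rule has_integral_spike[OF N, rotated]) (simp add: g0_def)
qed

lemma ennreal_add_le_less_mono:
  fixes a b c d :: ennreal
  assumes "a \<le> c" "b < d" "c < \<infinity>"
  shows "a + b < c + d"
proof -
  have "a + b \<le> c + b" using assms(1) by (rule add_right_mono)
  also have "\<dots> < c + d" using assms(2,3) by (subst ennreal_add_left_cancel_less) auto
  finally show ?thesis .
qed

text \<open>Cutting \<open>h\<close> off at a large \<open>k\<close> loses less than \<open>e / 2\<close> of the integral by monotone convergence, and the bounded
  part contributes at most \<open>k\<close> times the measure of \<open>A\<close>.\<close>
lemma nn_integral_absolutely_continuous:
  fixes h :: "'a \<Rightarrow> ennreal"
  assumes [measurable]: "h \<in> borel_measurable M" and fin: "(\<integral>\<^sup>+x. h x \<partial>M) < \<infinity>" and "0 < e"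
  obtains \<delta> :: real where "0 < \<delta>"
    "\<And>A. A \<in> sets M \<Longrightarrow> emeasure M A < ennreal \<delta> \<Longrightarrow> (\<integral>\<^sup>+x\<in>A. h x \<partial>M) < ennreal e"
proof -
  let ?m = "\<lambda>k x. inf (h x) (of_nat k)"
  have "(SUP k. ?m k x) = h x" for x
    by (simp add: inf_SUP[symmetric] ennreal_SUP_of_nat_eq_top)
  then have "(\<integral>\<^sup>+x. h x \<partial>M) = (\<integral>\<^sup>+x. (SUP k. ?m k x) \<partial>M)" by simp
  also have "\<dots> = (SUP k. \<integral>\<^sup>+x. ?m k x \<partial>M)"
    by (intro nn_integral_monotone_convergence_SUP) (auto simp: incseq_def le_fun_def intro: le_infI2)
  finally have "(\<integral>\<^sup>+x. h x \<partial>M) + ennreal (e / 2) = (SUP k. (\<integral>\<^sup>+x. ?m k x \<partial>M) + ennreal (e / 2))"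
    by (subst ennreal_SUP_add_left) auto
  moreover have "(\<integral>\<^sup>+x. h x \<partial>M) + 0 < (\<integral>\<^sup>+x. h x \<partial>M) + ennreal (e / 2)"
    using fin \<open>0 < e\<close> by (subst ennreal_add_left_cancel_less) auto
  ultimately obtain k where k: "(\<integral>\<^sup>+x. h x \<partial>M) < (\<integral>\<^sup>+x. ?m k x \<partial>M) + ennreal (e / 2)"
    by (auto simp: less_SUP_iff)
  have m_fin: "(\<integral>\<^sup>+x. ?m k x \<partial>M) \<noteq> \<infinity>"
    using fin nn_integral_mono[of M "?m k" h] by (auto simp: less_top[symmetric] top_unique)
  have tail: "(\<integral>\<^sup>+x. h x - ?m k x \<partial>M) < ennreal (e / 2)"
  proof -
    have "(\<integral>\<^sup>+x. h x - ?m k x \<partial>M) = (\<integral>\<^sup>+x. h x \<partial>M) - (\<integral>\<^sup>+x. ?m k x \<partial>M)"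
      using m_fin by (intro nn_integral_diff) auto
    also have "\<dots> < ennreal (e / 2)"
      using k m_fin by (subst minus_less_iff_ennreal)
        (auto simp: add.commute less_top intro!: nn_integral_mono)
    finally show ?thesis .
  qed
  define \<delta> where "\<delta> = e / (2 * (real k + 1))"
  show ?thesis
  proof (rule that[of \<delta>])
    show "0 < \<delta>" using \<open>0 < e\<close> by (simp add: \<delta>_def)
    fix A assume A [measurable]: "A \<in> sets M" and small: "emeasure M A < ennreal \<delta>"
    have "(\<integral>\<^sup>+x\<in>A. h x \<partial>M) \<le> (\<integral>\<^sup>+x. of_nat k * indicator A x + (h x - ?m k x) \<partial>M)"
    proof (intro nn_integral_mono)
      fix x
      have "h x \<le> of_nat k + (h x - ?m k x)"
        by (cases "h x \<le> of_nat k")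
          (simp_all add: inf_absorb1 inf_absorb2 add_diff_inverse_ennreal add_increasing2)
      then show "h x * indicator A x \<le> of_nat k * indicator A x + (h x - ?m k x)"
        by (auto split: split_indicator)
    qed
    also have "\<dots> = of_nat k * emeasure M A + (\<integral>\<^sup>+x. h x - ?m k x \<partial>M)"
      by (subst nn_integral_add) (auto simp: nn_integral_cmult_indicator)
    also have "\<dots> < ennreal (e / 2) + ennreal (e / 2)"
    proof (rule ennreal_add_le_less_mono)
      have "of_nat k * emeasure M A \<le> ennreal (real k) * ennreal \<delta>"
        using small by (intro mult_mono) (auto simp: ennreal_of_nat_eq_real_of_nat)
      also have "\<dots> = ennreal (real k * \<delta>)" using \<open>0 < \<delta>\<close> by (simp add: ennreal_mult)
      also have "\<dots> \<le> ennreal (e / 2)"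
        using \<open>0 < e\<close> by (intro ennreal_leI) (simp add: \<delta>_def field_simps)
      finally show "of_nat k * emeasure M A \<le> ennreal (e / 2)" .
    qed (use tail in auto)
    also have "\<dots> = ennreal e" using \<open>0 < e\<close> by (simp flip: ennreal_plus)
    finally show "(\<integral>\<^sup>+x\<in>A. h x \<partial>M) < ennreal e" .
  qed
qed

section \<open>Length as the integral of the speed\<close>

lemma rectifiable_component:
  fixes f :: "real \<Rightarrow> real ^ 'M"
  assumes "rectifiable a b f" "a \<le> b"
  shows "rectifiable a b (\<lambda>x. f x $ m)"
proof (rule rectifiable_if_increments_dominated[OF _ assms(2,1), where c = 0])
  fix u v
  show "norm (f v $ m - f u $ m) \<le> norm (f v - f u) + 0 * (v - u)"
    using Finite_Cartesian_Product.norm_nth_le[of "f v - f u" m] by simp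
qed

text \<open>The end points are put into \<open>N\<close>: only at interior points does a derivative within \<open>{a..b}\<close> agree with the two-sided
  one.\<close>
lemma rectifiable_has_curve_deriv_ae:
  fixes f :: "real \<Rightarrow> real ^ 'M"
  assumes rect: "rectifiable a b f" and "a \<le> b"
  obtains N where "negligible N" "\<And>x. x \<in> {a..b} - N \<Longrightarrow> (f has_vector_derivative curve_deriv a b f x) (at x)"
proof -
  define N where "N = {a, b} \<union> (\<Union>m. {x \<in> {a..b}. \<not> (\<lambda>t. f t $ m) differentiable at x})"
  have "negligible (\<Union>m. {x \<in> {a..b}. \<not> (\<lambda>t. f t $ m) differentiable at x})"
    using rectifiable_imp_differentiable_ae[OF rectifiable_component[OF assms] \<open>a \<le> b\<close>]
    by (intro negligible_Union) auto
  then have "negligible N" unfolding N_def by (intro negligible_Un) simp_all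
  moreover have "(f has_vector_derivative curve_deriv a b f x) (at x)" if x: "x \<in> {a..b} - N" for x
  proof -
    have inner: "at x within {a..b} = at x" using x by (intro at_within_Icc_at) (auto simp: N_def)
    have comp: "((\<lambda>t. f t $ m) has_vector_derivative curve_deriv a b f x $ m) (at x)" for m
    proof -
      have "(\<lambda>t. f t $ m) differentiable at x" using x by (auto simp: N_def)
      then show ?thesis by (simp add: curve_deriv_def inner vector_derivative_works)
    qed
    show ?thesis
      unfolding has_vector_derivative_def has_derivative_componentwise_within[of f _ x UNIV]
    proof
      fix i :: "real ^ 'M" assume "i \<in> Basis"
      then obtain m where "i = axis m 1" by (auto simp: Basis_vec_def)
      then show "((\<lambda>t. f t \<bullet> i) has_derivative (\<lambda>h. h *\<^sub>R curve_deriv a b f x \<bullet> i)) (at x)"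
        using comp[of m] by (simp add: inner_axis has_vector_derivative_def)
    qed
  qed
  ultimately show ?thesis using that by blast
qed

text \<open>The fundamental theorem for each component shows that the gauge integral of \<open>D\<close> is the chord. As the speed has
  finite integral, this is also a Lebesgue integral, whose norm is at most the integral of the norm.\<close>
lemma chord_le_speed_integral_if_absolutely_continuous:
  fixes f :: "real \<Rightarrow> real ^ 'M"
  assumes ac: "\<And>m. absolutely_continuous_on a b (\<lambda>x. f x $ m)" and uv: "a \<le> u" "u \<le> v" "v \<le> b"
    and N: "negligible N" and D: "\<And>x. x \<in> {a..b} - N \<Longrightarrow> (f has_vector_derivative D x) (at x)"
    and fin: "(\<integral>\<^sup>+x\<in>{u..v}. ennreal (norm (D x)) \<partial>lebesgue) < \<infinity>"
  shows "ennreal (norm (f v - f u)) \<le> (\<integral>\<^sup>+x\<in>{u..v}. ennreal (norm (D x)) \<partial>lebesgue)"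
proof -
  have hi: "(D has_integral (f v - f u)) {u..v}"
  proof (rule has_integral_componentwise)
    fix i :: "real ^ 'M" assume "i \<in> Basis"
    then obtain m where m: "i = axis m 1" by (auto simp: Basis_vec_def)
    have "((\<lambda>x. D x $ m) has_integral (f v $ m - f u $ m)) {u..v}"
    proof (rule absolutely_continuous_has_integral[OF _ uv(2) N])
      show "absolutely_continuous_on u v (\<lambda>x. f x $ m)"
        by (rule absolutely_continuous_on_subinterval[OF ac uv(1,3)])
      fix x assume "x \<in> {u..v} - N"
      then have "(f has_vector_derivative D x) (at x)" using uv by (intro D) auto
      then have "((\<lambda>x. f x $ m) has_vector_derivative D x $ m) (at x)"
        by (rule bounded_linear.has_vector_derivative[OF bounded_linear_vec_nth])
      then show "((\<lambda>x. f x $ m) has_vector_derivative D x $ m) (at x within {u..v})"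
        by (rule has_vector_derivative_at_within)
    qed
    then show "((\<lambda>x. D x \<bullet> i) has_integral (f v - f u) \<bullet> i) {u..v}"
      by (simp add: m inner_axis)
  qed
  have eq: "(\<integral>\<^sup>+x. ennreal (norm (indicator {u..v} x *\<^sub>R D x)) \<partial>lebesgue) =
      (\<integral>\<^sup>+x\<in>{u..v}. ennreal (norm (D x)) \<partial>lebesgue)"
    by (intro nn_integral_cong) (auto split: split_indicator)
  have int: "integrable lebesgue (\<lambda>x. indicator {u..v} x *\<^sub>R D x)"
    using has_integral_implies_lebesgue_measurable[OF hi] fin by (intro integrableI_bounded) (simp_all only: eq)
  then have "(D has_integral (LINT x:{u..v}|lebesgue. D x)) {u..v}"
    by (intro has_integral_set_lebesgue) (simp add: set_integrable_def)
  then have "f v - f u = (\<integral>x. indicator {u..v} x *\<^sub>R D x \<partial>lebesgue)"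
    using has_integral_unique[OF hi] by (simp add: set_lebesgue_integral_def)
  then show ?thesis using integral_norm_bound_ennreal[OF int] by (simp only: eq)
qed

theorem mainTheorem1:
  fixes f :: "real \<Rightarrow> real ^ 'M" and a b :: real
  assumes "a < b"
    and "continuous_on {a..b} f"
    and "rectifiable a b f"
  shows "curve_length a b f = (\<integral>\<^sup>+x\<in>{a..b}. ennreal (norm (curve_deriv a b f x)) \<partial>lebesgue) \<longleftrightarrow>
         (\<forall>m. absolutely_continuous_on a b (\<lambda>x. f x $ m))"
proof -
  define D where "D = curve_deriv a b f"
  obtain N where N: "negligible N" and D: "\<And>x. x \<in> {a..b} - N \<Longrightarrow> (f has_vector_derivative D x) (at x)"
    using rectifiable_has_curve_deriv_ae[OF assms(3)] \<open>a < b\<close> unfolding D_def by (metis less_imp_le)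
  have D_ae: "AE x in lebesgue. x \<in> {u..v} \<longrightarrow> (f has_vector_derivative D x) (at x)" if "a \<le> u" "v \<le> b" for u v
  proof (rule AE_I'[of N])
    have "x \<in> N" if "x \<in> {u..v}" "\<not> (f has_vector_derivative D x) (at x)" for x
      using D[of x] that \<open>a \<le> u\<close> \<open>v \<le> b\<close> by auto
    then show "{x \<in> space lebesgue. \<not> (x \<in> {u..v} \<longrightarrow> (f has_vector_derivative D x) (at x))} \<subseteq> N" by blast
  qed (use N in \<open>simp add: negligible_iff_null_sets\<close>)
  define h where "h x = ennreal (norm (D x) * indicator {a..b} x)" for x
  have h_meas [measurable]: "h \<in> borel_measurable lebesgue"
    unfolding h_def using speed_measurable[OF \<open>a < b\<close> D_ae[OF order_refl order_refl]] by measurable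
  have h_ind: "(\<lambda>x. h x * indicator {u<..<v} x) \<in> borel_measurable lebesgue" for u v :: real
    by (intro borel_measurable_times_ennreal h_meas borel_measurable_indicator) simp
  define S where "S u v = (\<integral>\<^sup>+x\<in>{u..v}. ennreal (norm (D x)) \<partial>lebesgue)" for u v
  define \<nu> where "\<nu> = density lebesgue h"
  have \<nu>_sets: "{u<..<v} \<in> sets \<nu>" for u v :: real by (simp add: \<nu>_def)
  \<comment> \<open>Open intervals are used because those of a partition are disjoint; the end points are null.\<close>
  have S_\<nu>: "S u v = emeasure \<nu> {u<..<v}" if "a \<le> u" "v \<le> b" for u v
  proof -
    have "S u v = (\<integral>\<^sup>+x. h x * indicator {u<..<v} x \<partial>lebesgue)"
      unfolding S_def
    proof (rule nn_integral_cong_AE)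
      show "AE x in lebesgue. ennreal (norm (D x)) * indicator {u..v} x = h x * indicator {u<..<v} x"
        using AE_lebesgue_neq[of u] AE_lebesgue_neq[of v]
        by eventually_elim (use that in \<open>auto simp: h_def split: split_indicator\<close>)
    qed
    also have "\<dots> = emeasure \<nu> {u<..<v}" unfolding \<nu>_def by (subst emeasure_density) auto
    finally show ?thesis .
  qed
  have S_le: "S u v \<le> curve_length u v f" if "a \<le> u" "u < v" "v \<le> b" for u v
    unfolding S_def using that by (intro nn_integral_speed_le_curve_length D_ae) auto
  have len_fin: "curve_length a b f < \<infinity>" using assms(3) by (simp add: rectifiable_def)
  then have S_fin: "S a b < \<infinity>" using S_le[of a b] \<open>a < b\<close> by (simp add: le_less_trans)
  show ?thesis
    unfolding D_def[symmetric] S_def[symmetric]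
  proof
    assume eq: "curve_length a b f = S a b"
    have S0: "S u v \<le> curve_length u v f" if "a \<le> u" "u \<le> v" "v \<le> b" for u v
      using S_le[of u v] S_\<nu>[of u v] that by (cases "u = v") auto
    \<comment> \<open>The speed integral is additive and the length superadditive; as the former never exceeds the latter, equality
      on the whole interval leaves no room for a strict inequality on a part.\<close>
    have len_le: "curve_length u v f \<le> S u v" if uv: "a \<le> u" "u < v" "v \<le> b" for u v
    proof -
      have "curve_length a u f + curve_length u v f + curve_length v b f \<le> curve_length a b f"
        using uv by (intro curve_length_superadditive3) auto
      also have "\<dots> = (\<integral>\<^sup>+x. h x * indicator {a<..<b} x \<partial>lebesgue)"
        using eq S_\<nu>[of a b] by (simp add: \<nu>_def emeasure_density)
      also have "\<dots> \<le> (\<integral>\<^sup>+x. h x * indicator {a<..<u} x + h x * indicator {u<..<v} x + h x * indicator {v<..<b} x \<partial>lebesgue)"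
      proof (rule nn_integral_mono_AE)
        show "AE x in lebesgue. h x * indicator {a<..<b} x \<le>
            h x * indicator {a<..<u} x + h x * indicator {u<..<v} x + h x * indicator {v<..<b} x"
          using AE_lebesgue_neq[of u] AE_lebesgue_neq[of v]
          by eventually_elim (auto split: split_indicator)
      qed
      also have "\<dots> = S a u + S u v + S v b"
        using uv by (simp add: S_\<nu> \<nu>_def emeasure_density nn_integral_add h_ind borel_measurable_add)
      also have "\<dots> \<le> curve_length a u f + S u v + curve_length v b f"
        using uv by (intro add_mono S0 order_refl) auto
      finally have "(curve_length a u f + curve_length v b f) + curve_length u v f \<le>
          (curve_length a u f + curve_length v b f) + S u v"
        by (simp add: ac_simps)
      moreover have "curve_length a u f + curve_length v b f < \<infinity>"
      proof -
        have "curve_length a u f + curve_length v b f \<le> curve_length a u f + curve_length u v f + curve_length v b f"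
          by (intro add_right_mono) simp
        also have "\<dots> \<le> curve_length a b f" using uv by (intro curve_length_superadditive3) auto
        finally show ?thesis using len_fin by (rule le_less_trans)
      qed
      ultimately show ?thesis by (subst (asm) ennreal_add_left_cancel_le) auto
    qed
    show "\<forall>m. absolutely_continuous_on a b (\<lambda>x. f x $ m)"
      unfolding absolutely_continuous_on_def
    proof (intro allI impI)
      fix m and e :: real assume "0 < e"
      have "(\<integral>\<^sup>+x. h x \<partial>lebesgue) = S a b"
        unfolding S_def h_def by (intro nn_integral_cong) (auto split: split_indicator)
      then have "(\<integral>\<^sup>+x. h x \<partial>lebesgue) < \<infinity>" using S_fin by simp
      then obtain \<delta> where \<delta>: "0 < \<delta>" "\<And>A. A \<in> sets lebesgue \<Longrightarrow> emeasure lebesgue A < ennreal \<delta> \<Longrightarrow>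
          (\<integral>\<^sup>+x\<in>A. h x \<partial>lebesgue) < ennreal e"
        using nn_integral_absolutely_continuous[OF h_meas _ \<open>0 < e\<close>] by metis
      have "(\<Sum>i<n. \<bar>f (v i) $ m - f (u i) $ m\<bar>) < e"
        if uv: "\<forall>i<n. a \<le> u i \<and> u i < v i \<and> v i \<le> b" and disj: "disjoint_family_on (\<lambda>i. {u i<..<v i}) {..<n}"
          and small: "(\<Sum>i<n. v i - u i) < \<delta>" for n :: nat and u v
      proof -
        let ?A = "\<Union>i\<in>{..<n}. {u i<..<v i}"
        have "emeasure lebesgue ?A = (\<Sum>i<n. emeasure lebesgue {u i<..<v i})"
          using disj by (intro sum_emeasure[symmetric]) auto
        also have "\<dots> = (\<Sum>i<n. ennreal (v i - u i))"
          using uv by (intro sum.cong) (auto simp: less_imp_le)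
        also have "\<dots> = ennreal (\<Sum>i<n. v i - u i)"
          using uv by (intro sum_ennreal) (auto simp: less_imp_le)
        also have "\<dots> < ennreal \<delta>" using small \<delta>(1) by (simp add: ennreal_lessI)
        finally have A: "emeasure lebesgue ?A < ennreal \<delta>" .
        have "ennreal (\<Sum>i<n. \<bar>f (v i) $ m - f (u i) $ m\<bar>) = (\<Sum>i<n. ennreal \<bar>f (v i) $ m - f (u i) $ m\<bar>)"
          by (intro sum_ennreal[symmetric]) auto
        also have "\<dots> \<le> (\<Sum>i<n. emeasure \<nu> {u i<..<v i})"
        proof (intro sum_mono)
          fix i assume "i \<in> {..<n}"
          then have i: "a \<le> u i" "u i < v i" "v i \<le> b" using uv by auto
          have "ennreal \<bar>f (v i) $ m - f (u i) $ m\<bar> \<le> ennreal (norm (f (v i) - f (u i)))"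
            using Finite_Cartesian_Product.norm_nth_le[of "f (v i) - f (u i)" m] by (intro ennreal_leI) simp
          also have "\<dots> \<le> curve_length (u i) (v i) f" using i by (intro norm_diff_le_curve_length) simp
          also have "\<dots> \<le> S (u i) (v i)" using i by (rule len_le)
          also have "\<dots> = emeasure \<nu> {u i<..<v i}" using i by (intro S_\<nu>)
          finally show "ennreal \<bar>f (v i) $ m - f (u i) $ m\<bar> \<le> emeasure \<nu> {u i<..<v i}" .
        qed
        also have "\<dots> = emeasure \<nu> ?A"
          using disj by (intro sum_emeasure) (auto simp: \<nu>_sets)
        also have "\<dots> = (\<integral>\<^sup>+x\<in>?A. h x \<partial>lebesgue)" unfolding \<nu>_def by (rule emeasure_density) auto
        also have "\<dots> < ennreal e" using A by (intro \<delta>(2)) auto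
        finally show ?thesis using \<open>0 < e\<close> by (simp add: ennreal_less_iff sum_nonneg)
      qed
      then show "\<exists>\<delta>>0. \<forall>(n::nat) u v. (\<forall>i<n. a \<le> u i \<and> u i < v i \<and> v i \<le> b) \<longrightarrow>
          disjoint_family_on (\<lambda>i. {u i<..<v i}) {..<n} \<longrightarrow> (\<Sum>i<n. v i - u i) < \<delta> \<longrightarrow>
          (\<Sum>i<n. \<bar>f (v i) $ m - f (u i) $ m\<bar>) < e"
        using \<delta>(1) by (intro exI[of _ \<delta>] conjI allI impI)
    qed
  next
    assume ac: "\<forall>m. absolutely_continuous_on a b (\<lambda>x. f x $ m)"
    have "ennreal (polygon_length f n x) \<le> S a b" if p: "is_partition a b n x" for n x
    proof -
      have cell: "a \<le> x i" "x i < x (Suc i)" "x (Suc i) \<le> b" if "i < n" for i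
        using is_partition_bounds[OF p, of i] is_partition_bounds[OF p, of "Suc i"] p that
        by (auto simp: is_partition_def)
      have "ennreal (polygon_length f n x) = (\<Sum>i<n. ennreal (norm (f (x (Suc i)) - f (x i))))"
        by (simp add: polygon_length_lessThan)
      also have "\<dots> \<le> (\<Sum>i<n. emeasure \<nu> {x i<..<x (Suc i)})"
      proof (intro sum_mono)
        fix i assume "i \<in> {..<n}"
        then have i: "i < n" by simp
        have S_i: "S (x i) (x (Suc i)) \<le> S a b"
          using cell[OF i] \<open>a < b\<close> by (simp add: S_\<nu>) (intro emeasure_mono \<nu>_sets, auto)
        have "ennreal (norm (f (x (Suc i)) - f (x i))) \<le> S (x i) (x (Suc i))"
          unfolding S_def
          by (rule chord_le_speed_integral_if_absolutely_continuous[OF ac[rule_format] _ _ _ N D])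
             (use cell[OF i] le_less_trans[OF S_i S_fin] in \<open>auto simp: S_def\<close>)
        then show "ennreal (norm (f (x (Suc i)) - f (x i))) \<le> emeasure \<nu> {x i<..<x (Suc i)}"
          using cell[OF i] by (simp add: S_\<nu>)
      qed
      also have "\<dots> = emeasure \<nu> (\<Union>i\<in>{..<n}. {x i<..<x (Suc i)})"
      proof (intro sum_emeasure)
        show "disjoint_family_on (\<lambda>i. {x i<..<x (Suc i)}) {..<n}"
          unfolding disjoint_family_on_def
        proof (intro ballI impI)
          fix i j assume "i \<in> {..<n}" "j \<in> {..<n}" "i \<noteq> j"
          then have "x (Suc i) \<le> x j \<or> x (Suc j) \<le> x i"
            using is_partition_mono[OF p, of "Suc i" j] is_partition_mono[OF p, of "Suc j" i] by (cases "i < j") auto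
          then show "{x i<..<x (Suc i)} \<inter> {x j<..<x (Suc j)} = {}" by auto
        qed
      qed (auto simp: \<nu>_sets)
      also have "\<dots> \<le> emeasure \<nu> {a<..<b}"
      proof (intro emeasure_mono \<nu>_sets UN_least)
        fix i assume "i \<in> {..<n}"
        then show "{x i<..<x (Suc i)} \<subseteq> {a<..<b}" using cell[of i] by auto
      qed
      also have "\<dots> = S a b" by (simp add: S_\<nu>)
      finally show ?thesis .
    qed
    then have "curve_length a b f \<le> S a b" unfolding curve_length_def by (intro SUP_least) auto
    then show "curve_length a b f = S a b" using S_le[of a b] \<open>a < b\<close> by (intro antisym) auto
  qed
qed

end
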